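(* There is a constant $C$ such that for every $N$ and every two binary strings $a,b$ of length at most $N$ there exists a program $f$ which on input $a$ outputs $b$ and satisfies $$\bigl|\mathrm{KS}(b\mid f)-\min\{\mathrm{KS}(a),\mathrm{KS}(b)\}\bigr|\le C\log N.$$ (Equivalently, one may take $f$ to be a total function from the set of binary strings of length at most $N$ to itself with $f(a)=b$, encoded as a finite object.)
   Context: $\mathrm{KS}(u)$ and $\mathrm{KS}(u\mid v)$ denote plain and conditional Kolmogorov complexity of binary strings with respect to a fixed optimal programming language; programs and finite functions are regarded as binary strings via a fixed encoding. All $O(\log N)$ terms are up to a constant not depending on the strings or $N$. *)

theory Defs
  imports Complex_Main
begin

datatype recf =
    Zr
  | Sc
  | Pj nat
  | Cn recf "recf list"
  | Pr recf recf
  | Mn recf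

inductive rec_eval :: "recf \<Rightarrow> nat list \<Rightarrow> nat \<Rightarrow> bool" where
  ev_Zr: "rec_eval Zr xs 0"
| ev_Sc: "rec_eval Sc (x # xs) (Suc x)"
| ev_Pj: "i < length xs \<Longrightarrow> rec_eval (Pj i) xs (xs ! i)"
| ev_Cn: "\<lbrakk> length ys = length hs; \<forall>i < length hs. rec_eval (hs ! i) xs (ys ! i);
            rec_eval g ys r \<rbrakk> \<Longrightarrow> rec_eval (Cn g hs) xs r"
| ev_Pr0: "rec_eval f xs r \<Longrightarrow> rec_eval (Pr f g) (0 # xs) r"
| ev_PrS: "\<lbrakk> rec_eval (Pr f g) (n # xs) r; rec_eval g (n # r # xs) s \<rbrakk>
            \<Longrightarrow> rec_eval (Pr f g) (Suc n # xs) s"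
| ev_Mn: "\<lbrakk> rec_eval f (n # xs) 0; \<forall>m < n. \<exists>v. 0 < v \<and> rec_eval f (m # xs) v \<rbrakk>
            \<Longrightarrow> rec_eval (Mn f) xs n"

text \<open>Binary strings are bool lists; they are numbered bijectively (bijective base 2).\<close>

primrec str_num :: "bool list \<Rightarrow> nat" where
  "str_num [] = 0"
| "str_num (b # bs) = 2 * str_num bs + (if b then 2 else 1)"

definition computable2 :: "(bool list \<Rightarrow> bool list \<Rightarrow> bool list option) \<Rightarrow> bool" where
  "computable2 D \<longleftrightarrow> (\<exists>F. \<forall>p y x. D p y = Some x \<longleftrightarrow> rec_eval F [str_num p, str_num y] (str_num x))"

definition optimal :: "(bool list \<Rightarrow> bool list \<Rightarrow> bool list option) \<Rightarrow> bool" where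
  "optimal U \<longleftrightarrow> computable2 U \<and>
     (\<forall>D. computable2 D \<longrightarrow> (\<exists>c::nat. \<forall>p y x. D p y = Some x \<longrightarrow>
          (\<exists>q. U q y = Some x \<and> length q \<le> length p + c)))"

definition KSc :: "(bool list \<Rightarrow> bool list \<Rightarrow> bool list option) \<Rightarrow> bool list \<Rightarrow> bool list \<Rightarrow> nat" where
  "KSc U x y = (LEAST n. \<exists>p. length p = n \<and> U p y = Some x)"

definition KS :: "(bool list \<Rightarrow> bool list \<Rightarrow> bool list option) \<Rightarrow> bool list \<Rightarrow> nat" where
  "KS U x = KSc U x []"

fun strs_len :: "nat \<Rightarrow> bool list list" where
  "strs_len 0 = [[]]"
| "strs_len (Suc n) = concat (map (\<lambda>b. map (Cons b) (strs_len n)) [False, True])"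

definition strs_upto :: "nat \<Rightarrow> bool list list" where
  "strs_upto N = concat (map strs_len [0..<Suc N])"

text \<open>Self-delimiting code of a string: every bit doubled, terminated by 01.\<close>

definition sd_code :: "bool list \<Rightarrow> bool list" where
  "sd_code x = concat (map (\<lambda>b. [b, b]) x) @ [False, True]"

definition table_code :: "nat \<Rightarrow> (bool list \<Rightarrow> bool list) \<Rightarrow> bool list" where
  "table_code N f = concat (map (\<lambda>x. sd_code (f x)) (strs_upto N))"

end

theory Submission
  imports Defs "HOL-Library.Nat_Bijection"
begin

text \<open>
  Call a pair \<open>(a, b)\<close> forced at level \<open>s\<close> if every table \<open>f\<close> with \<open>f(a) = b\<close> satisfies
  \<open>KS(b | f) < s\<close>. Given \<open>N\<close> and \<open>s\<close>, the forced pairs can be enumerated. A matching of forced pairs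
  has fewer than \<open>2^s\<close> members: one table \<open>f\<close> passes through all of them, and their second components
  are pairwise different strings of complexity less than \<open>s\<close> relative to \<open>f\<close>. Build a maximal matching
  greedily along the enumeration. By maximality every forced pair \<open>(a, b)\<close> shares its first or its
  second component with a member of the matching, so \<open>a\<close> or \<open>b\<close> is described by \<open>N\<close>, \<open>s\<close> and an index
  of at most \<open>s\<close> bits, whence \<open>min(KS(a), KS(b)) \<le> s + O(log N)\<close>. Now choose \<open>f\<close> with \<open>f(a) = b\<close>
  maximizing \<open>KS(b | f)\<close> and apply this with \<open>s = KS(b | f) + 1\<close>. The upper bounds
  \<open>KS(b | f) \<le> KS(a) + O(1)\<close> (look \<open>a\<close> up in the table) and \<open>KS(b | f) \<le> KS(b) + O(1)\<close> hold for every
  \<open>f\<close>.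
\<close>

section \<open>Total recursive functions\<close>

text \<open>Induction on the first derivation, inverting the second. For \<open>Mn\<close>, if the
  two results differed, one derivation would give \<open>f\<close> the value 0 at the smaller of
  them and the other a positive value.\<close>

lemma rec_eval_det: "rec_eval F xs y \<Longrightarrow> rec_eval F xs y' \<Longrightarrow> y = y'"
proof (induction arbitrary: y' rule: rec_eval.induct)
  case (ev_Zr xs)
  then show ?case by (auto elim: rec_eval.cases)
next
  case (ev_Sc x xs)
  then show ?case by (auto elim: rec_eval.cases)
next
  case (ev_Pj i xs)
  from ev_Pj.prems show ?case by (cases) auto
next
  case (ev_Cn ys hs xs g r)
  from ev_Cn.prems obtain zs where zs: "length zs = length hs"
    "\<forall>i < length hs. rec_eval (hs ! i) xs (zs ! i)" "rec_eval g zs y'"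
    by (cases) auto
  have "ys = zs" using ev_Cn zs by (auto intro: nth_equalityI)
  then show ?case using ev_Cn.IH zs by auto
next
  case (ev_Pr0 f xs r g)
  from ev_Pr0.prems show ?case by (cases) (auto dest: ev_Pr0.IH)
next
  case (ev_PrS f g n xs r s)
  from ev_PrS.prems show ?case by (cases) (auto dest!: ev_PrS.IH)
next
  case (ev_Mn f n xs)
  from ev_Mn.prems have A: "rec_eval f (y' # xs) 0" "\<forall>m < y'. \<exists>v. 0 < v \<and> rec_eval f (m # xs) v"
    by (cases, auto)+
  show ?case
  proof (rule linorder_cases[of n y'])
    assume "n < y'"
    then obtain v where "0 < v" "rec_eval f (n # xs) v" using A by blast
    then show ?thesis using ev_Mn.IH(1) by blast
  next
    assume "y' < n"
    then obtain v where "0 < v" "\<forall>w. rec_eval f (y' # xs) w \<longrightarrow> v = w"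
      using ev_Mn.IH by blast
    then show ?thesis using A by blast
  qed
qed

text \<open>Programs carry no arity of their own, so it is recorded here; on lists of other lengths
  nothing is claimed about \<open>F\<close>.\<close>

definition total_rec :: "nat \<Rightarrow> (nat list \<Rightarrow> nat) \<Rightarrow> bool" where
  "total_rec n f \<longleftrightarrow> (\<exists>F. \<forall>xs. length xs = n \<longrightarrow> rec_eval F xs (f xs))"

lemma total_rec_cong:
  "(\<And>xs. length xs = n \<Longrightarrow> f xs = g xs) \<Longrightarrow> total_rec n f \<longleftrightarrow> total_rec n g"
  unfolding total_rec_def by simp

lemma total_rec_0: "total_rec n (\<lambda>xs. 0)"
  unfolding total_rec_def by (blast intro: ev_Zr)

lemma total_rec_nth: "i < n \<Longrightarrow> total_rec n (\<lambda>xs. xs ! i)"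
  unfolding total_rec_def by (blast intro: ev_Pj)

lemma total_rec_Cn:
  assumes "total_rec (length fs) g" "\<And>f. f \<in> set fs \<Longrightarrow> total_rec n f"
  shows "total_rec n (\<lambda>xs. g (map (\<lambda>f. f xs) fs))"
proof -
  obtain G where G: "\<And>xs. length xs = length fs \<Longrightarrow> rec_eval G xs (g xs)"
    using assms(1) unfolding total_rec_def by blast
  have "\<forall>f\<in>set fs. \<exists>F. \<forall>xs. length xs = n \<longrightarrow> rec_eval F xs (f xs)"
    using assms(2) unfolding total_rec_def by blast
  then obtain H where H: "\<And>f xs. f \<in> set fs \<Longrightarrow> length xs = n \<Longrightarrow> rec_eval (H f) xs (f xs)"
    by metis
  have "rec_eval (Cn G (map H fs)) xs (g (map (\<lambda>f. f xs) fs))" if "length xs = n" for xs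
    by (rule ev_Cn[where ys = "map (\<lambda>f. f xs) fs"]) (auto intro!: G H that)
  then show ?thesis unfolding total_rec_def by blast
qed

lemma total_rec_Suc:
  assumes "total_rec n f" shows "total_rec n (\<lambda>xs. Suc (f xs))"
proof -
  have "total_rec (length [f]) (\<lambda>xs. Suc (xs ! 0))"
    unfolding total_rec_def
    by (rule exI[of _ Sc]) (auto simp: length_Suc_conv intro: ev_Sc)
  from total_rec_Cn[OF this, of n] show ?thesis using assms by simp
qed

lemma total_rec_1:
  assumes "total_rec 1 (\<lambda>ys. g (ys ! 0))" "total_rec n f"
  shows "total_rec n (\<lambda>xs. g (f xs))"
  using total_rec_Cn[of "[f]" "\<lambda>ys. g (ys ! 0)" n] assms by simp

lemma total_rec_2:
  assumes "total_rec 2 (\<lambda>ys. g (ys ! 0) (ys ! 1))" "total_rec n f1" "total_rec n f2"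
  shows "total_rec n (\<lambda>xs. g (f1 xs) (f2 xs))"
  using total_rec_Cn[of "[f1, f2]" "\<lambda>ys. g (ys ! 0) (ys ! 1)" n] assms
  by (auto simp: numeral_2_eq_2)

lemma total_rec_Pr:
  assumes "total_rec n f" "total_rec (Suc (Suc n)) g"
  shows "total_rec (Suc n) (\<lambda>xs. rec_nat (f (tl xs)) (\<lambda>k r. g (k # r # tl xs)) (hd xs))"
proof -
  obtain F G where F: "\<And>xs. length xs = n \<Longrightarrow> rec_eval F xs (f xs)"
    and G: "\<And>xs. length xs = Suc (Suc n) \<Longrightarrow> rec_eval G xs (g xs)"
    using assms unfolding total_rec_def by blast
  have *: "rec_eval (Pr F G) (k # xs) (rec_nat (f xs) (\<lambda>k r. g (k # r # xs)) k)"
    if "length xs = n" for xs k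
  proof (induction k)
    case 0 then show ?case using F[OF that] by (auto intro: ev_Pr0)
  next
    case (Suc k)
    from ev_PrS[OF this G] that show ?case by simp
  qed
  show ?thesis unfolding total_rec_def
    by (rule exI[of _ "Pr F G"]) (auto simp: length_Suc_conv intro: *)
qed

lemma total_rec_Pr1:
  assumes "total_rec 2 (\<lambda>ys. h (ys ! 0) (ys ! 1))"
  shows "total_rec 1 (\<lambda>xs. rec_nat c h (xs ! 0))"
proof -
  have "total_rec 0 (\<lambda>xs. c)" by (induction c) (auto intro: total_rec_0 total_rec_Suc)
  moreover have "total_rec (Suc (Suc 0)) (\<lambda>ys. h (ys ! 0) (ys ! 1))" using assms by (simp add: numeral_2_eq_2)
  ultimately have "total_rec (Suc 0) (\<lambda>xs. rec_nat c h (hd xs))"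
    using total_rec_Pr[of 0 "\<lambda>xs. c" "\<lambda>ys. h (ys ! 0) (ys ! 1)"] by simp
  then show ?thesis
    by (subst total_rec_cong[of 1 _ "\<lambda>xs. rec_nat c h (hd xs)"]) (auto simp: length_Suc_conv)
qed

text \<open>\<open>Pr\<close> expects the counter before the parameter; here the parameter comes
  first, so the result is composed with a swap of the two arguments.\<close>

lemma total_rec_Pr2:
  assumes "total_rec 1 (\<lambda>xs. f (xs ! 0))"
    and "total_rec 3 (\<lambda>ys. h (ys ! 2) (ys ! 0) (ys ! 1))"
  shows "total_rec 2 (\<lambda>xs. rec_nat (f (xs ! 0)) (h (xs ! 0)) (xs ! 1))"
proof -
  have "total_rec (Suc 1) (\<lambda>xs. rec_nat (f (tl xs ! 0))
      (\<lambda>k r. h ((k # r # tl xs) ! 2) ((k # r # tl xs) ! 0) ((k # r # tl xs) ! 1)) (hd xs))"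
    using assms by (intro total_rec_Pr) (simp_all add: numeral_3_eq_3)
  then have "total_rec 2 (\<lambda>xs. rec_nat (f (xs ! 1)) (h (xs ! 1)) (xs ! 0))"
    unfolding numeral_2_eq_2 One_nat_def
    by (subst (asm) total_rec_cong[of _ _ "\<lambda>xs. rec_nat (f (xs ! 1)) (h (xs ! 1)) (xs ! 0)"])
      (auto simp: length_Suc_conv)
  then have "total_rec 2 (\<lambda>xs. (\<lambda>a b. rec_nat (f b) (h b) a) (xs ! 0) (xs ! 1))"
    by simp
  from total_rec_2[OF this, of 2 "\<lambda>xs. xs ! 1" "\<lambda>xs. xs ! 0"]
  show ?thesis by (simp add: total_rec_nth)
qed

lemmas total_rec_basic = total_rec_0 total_rec_nth total_rec_Suc

lemma total_rec_add:
  assumes "total_rec n f" "total_rec n g" shows "total_rec n (\<lambda>xs. f xs + g xs)"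
proof -
  have eq: "a + b = rec_nat a (\<lambda>_ r. Suc r) b" for a b :: nat by (induction b) auto
  have "total_rec 2 (\<lambda>xs. rec_nat (xs ! 0) (\<lambda>_ r. Suc r) (xs ! 1))"
    by (rule total_rec_Pr2[of "\<lambda>x. x" "\<lambda>_ _ r. Suc r"]) (auto intro!: total_rec_basic)
  then have "total_rec 2 (\<lambda>xs. xs ! 0 + xs ! 1)" by (simp only: eq[symmetric])
  then show ?thesis using assms by (rule total_rec_2)
qed

lemma total_rec_diff:
  assumes "total_rec n f" "total_rec n g" shows "total_rec n (\<lambda>xs. f xs - g xs)"
proof -
  have eq1: "a - 1 = rec_nat 0 (\<lambda>k _. k) a" for a :: nat by (cases a) auto
  have "total_rec 1 (\<lambda>xs. rec_nat 0 (\<lambda>k _. k) (xs ! 0))"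
    by (rule total_rec_Pr1) (auto intro!: total_rec_basic)
  then have p: "total_rec 1 (\<lambda>xs. xs ! 0 - 1)" unfolding eq1 .
  have eq: "a - b = rec_nat a (\<lambda>_ r. r - 1) b" for a b :: nat by (induction b) auto
  have "total_rec 2 (\<lambda>xs. rec_nat (xs ! 0) (\<lambda>_ r. r - 1) (xs ! 1))"
    by (rule total_rec_Pr2[of "\<lambda>x. x" "\<lambda>_ _ r. r - 1"])
      (intro total_rec_1[where g = "\<lambda>y. y - 1", OF p] total_rec_basic; simp)+
  then have "total_rec 2 (\<lambda>xs. xs ! 0 - xs ! 1)" by (simp only: eq[symmetric])
  then show ?thesis using assms by (rule total_rec_2)
qed

lemma total_rec_triangle:
  assumes "total_rec n f" shows "total_rec n (\<lambda>xs. triangle (f xs))"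
proof -
  have eq: "triangle a = rec_nat 0 (\<lambda>k r. r + Suc k) a" for a :: nat by (induction a) auto
  have "total_rec 1 (\<lambda>xs. triangle (xs ! 0))" unfolding eq
    by (rule total_rec_Pr1) (auto intro!: total_rec_basic total_rec_add)
  then show ?thesis using assms by (rule total_rec_1)
qed

section \<open>Cantor pairing and its recursive inverse\<close>

definition npair :: "nat \<Rightarrow> nat \<Rightarrow> nat" where "npair x y = prod_encode (x, y)"
definition nfst :: "nat \<Rightarrow> nat" where "nfst z = fst (prod_decode z)"
definition nsnd :: "nat \<Rightarrow> nat" where "nsnd z = snd (prod_decode z)"

lemma nfst_npair [simp]: "nfst (npair x y) = x"
  and nsnd_npair [simp]: "nsnd (npair x y) = y"
  and npair_collapse [simp]: "npair (nfst z) (nsnd z) = z"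
  by (auto simp: npair_def nfst_def nsnd_def)

lemma nsnd_0 [simp]: "nsnd 0 = 0"
  by (simp add: nsnd_def prod_decode_def prod_decode_aux.simps)

lemma triangle_strict: "a < b \<Longrightarrow> triangle a + a < triangle b"
  by (induction b) (auto simp: less_Suc_eq)

lemma diagonal_unique:
  assumes "triangle d \<le> z" "z < triangle (Suc d)" "triangle e \<le> z" "z < triangle (Suc e)"
  shows "d = e"
proof (rule linorder_cases[of d e])
  assume "d < e"
  then have "triangle (Suc d) \<le> triangle e"
    using triangle_strict[of "Suc d" e] by (cases "Suc d = e") auto
  then show ?thesis using assms by simp
next
  assume "e < d"
  then have "triangle (Suc e) \<le> triangle d"
    using triangle_strict[of "Suc e" d] by (cases "Suc e = d") auto
  then show ?thesis using assms by simp
qed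

text \<open>The Cantor code of \<open>(x, y)\<close> is \<open>triangle (x + y) + x\<close>, so the
  sum of the components is the index of the antidiagonal containing \<open>z\<close>.\<close>

lemma diagonal:
  "triangle (nfst z + nsnd z) \<le> z" "z < triangle (Suc (nfst z + nsnd z))"
  "nfst z = z - triangle (nfst z + nsnd z)"
proof -
  have "z = triangle (nfst z + nsnd z) + nfst z"
    using npair_collapse[of z] by (simp add: npair_def prod_encode_def)
  then show "triangle (nfst z + nsnd z) \<le> z" "z < triangle (Suc (nfst z + nsnd z))"
    "nfst z = z - triangle (nfst z + nsnd z)" by auto
qed

text \<open>The truncated difference \<open>1 - (triangle (Suc r) - Suc k)\<close> is 1 exactly when
  \<open>Suc k\<close> has reached the start of the next antidiagonal. The recursion thus tracks the
  current antidiagonal, which makes unpairing primitive recursive.\<close>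

lemma diagonal_rec:
  "nfst z + nsnd z = rec_nat 0 (\<lambda>k r. r + (1 - (triangle (Suc r) - Suc k))) z"
  (is "_ = ?R z")
proof -
  have "triangle (?R z) \<le> z \<and> z < triangle (Suc (?R z))"
  proof (induction z)
    case (Suc z)
    show ?case
    proof (cases "Suc z = triangle (Suc (?R z))")
      case True
      then have "?R (Suc z) = Suc (?R z)" by simp
      then show ?thesis using True by simp
    next
      case False
      then have "Suc z < triangle (Suc (?R z))" using Suc by simp
      then have "?R (Suc z) = ?R z" by simp
      then show ?thesis using False Suc by simp
    qed
  qed auto
  then show ?thesis using diagonal[of z] diagonal_unique by blast
qed

lemma total_rec_npair:
  "total_rec n f \<Longrightarrow> total_rec n g \<Longrightarrow> total_rec n (\<lambda>xs. npair (f xs) (g xs))"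
  unfolding npair_def prod_encode_def by (auto intro!: total_rec_add total_rec_triangle)

lemma total_rec_diagonal:
  assumes "total_rec n f" shows "total_rec n (\<lambda>xs. nfst (f xs) + nsnd (f xs))"
proof -
  have one: "total_rec m (\<lambda>xs. 1)" for m
    using total_rec_Suc[OF total_rec_0] by simp
  have "total_rec 1 (\<lambda>xs. nfst (xs ! 0) + nsnd (xs ! 0))"
    unfolding diagonal_rec
    by (rule total_rec_Pr1) (intro total_rec_add total_rec_diff total_rec_triangle total_rec_basic one; simp)
  then show ?thesis using assms by (rule total_rec_1[of "\<lambda>z. nfst z + nsnd z"])
qed

lemma total_rec_nfst:
  assumes "total_rec n f" shows "total_rec n (\<lambda>xs. nfst (f xs))"
  by (subst diagonal(3)) (intro total_rec_diff total_rec_triangle total_rec_diagonal assms)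

lemma total_rec_nsnd:
  assumes "total_rec n f" shows "total_rec n (\<lambda>xs. nsnd (f xs))"
  using total_rec_diff[OF total_rec_diagonal[OF assms] total_rec_nfst[OF assms]] by simp

section \<open>Closure properties of computable unary functions\<close>

text \<open>Unary functions suffice: several arguments are packed with \<^const>\<open>npair\<close>, so an
  environment of variables is a nested pair and its variables are compositions of \<^const>\<open>nfst\<close> and
  \<^const>\<open>nsnd\<close>.\<close>

definition comput :: "(nat \<Rightarrow> nat) \<Rightarrow> bool" where
  "comput f \<longleftrightarrow> total_rec 1 (\<lambda>xs. f (xs ! 0))"

lemma total_rec_comput: "comput f \<Longrightarrow> total_rec n g \<Longrightarrow> total_rec n (\<lambda>xs. f (g xs))"
  unfolding comput_def by (rule total_rec_1)

lemma comput_comp: "comput f \<Longrightarrow> comput g \<Longrightarrow> comput (\<lambda>e. f (g e))"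
  unfolding comput_def by (rule total_rec_1)

lemma comput_id: "comput (\<lambda>e. e)"
  unfolding comput_def by (auto intro: total_rec_nth)

lemma comput_Suc: "comput f \<Longrightarrow> comput (\<lambda>e. Suc (f e))"
  unfolding comput_def by (rule total_rec_Suc)

lemma comput_const: "comput (\<lambda>e. c)"
proof (induction c)
  case 0 show ?case unfolding comput_def by (rule total_rec_0)
next
  case (Suc c) then show ?case by (rule comput_Suc)
qed

lemma comput_nfst: "comput f \<Longrightarrow> comput (\<lambda>e. nfst (f e))"
  unfolding comput_def by (rule total_rec_nfst)

lemma comput_nsnd: "comput f \<Longrightarrow> comput (\<lambda>e. nsnd (f e))"
  unfolding comput_def by (rule total_rec_nsnd)

lemma comput_npair: "comput f \<Longrightarrow> comput g \<Longrightarrow> comput (\<lambda>e. npair (f e) (g e))"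
  unfolding comput_def by (rule total_rec_npair)

lemma comput_add: "comput f \<Longrightarrow> comput g \<Longrightarrow> comput (\<lambda>e. f e + g e)"
  unfolding comput_def by (rule total_rec_add)

lemma comput_diff: "comput f \<Longrightarrow> comput g \<Longrightarrow> comput (\<lambda>e. f e - g e)"
  unfolding comput_def by (rule total_rec_diff)

lemma comput_comp2:
  assumes "comput (\<lambda>e. h (nfst e) (nsnd e))" "comput f" "comput g"
  shows "comput (\<lambda>e. h (f e) (g e))"
  using comput_comp[OF assms(1) comput_npair[OF assms(2,3)]] by simp

text \<open>The step function sees the environment, the counter and the previous value, packed in
  this order as \<open>((e, k), r)\<close>.\<close>

lemma comput_rec:
  assumes "comput z" "comput (\<lambda>e. h (nfst (nfst e)) (nsnd (nfst e)) (nsnd e))" "comput n"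
  shows "comput (\<lambda>e. rec_nat (z e) (h e) (n e))"
proof -
  have "total_rec 2 (\<lambda>xs. rec_nat (z (xs ! 0)) (h (xs ! 0)) (xs ! 1))"
  proof (rule total_rec_Pr2)
    show "total_rec 1 (\<lambda>xs. z (xs ! 0))" using assms(1) unfolding comput_def .
    have "total_rec 3 (\<lambda>ys. npair (npair (ys ! 2) (ys ! 0)) (ys ! 1))"
      by (intro total_rec_npair total_rec_nth) auto
    from total_rec_comput[OF assms(2) this]
    show "total_rec 3 (\<lambda>ys. h (ys ! 2) (ys ! 0) (ys ! 1))" by simp
  qed
  from total_rec_2[OF this, of 1 "\<lambda>xs. xs ! 0" "\<lambda>xs. n (xs ! 0)"] assms(3)
  show ?thesis unfolding comput_def by (simp add: total_rec_nth)
qed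

lemmas comput_basic = comput_id comput_const comput_Suc comput_nfst comput_nsnd comput_npair
  comput_add comput_diff

lemma comput_mult: assumes "comput f" "comput g" shows "comput (\<lambda>e. f e * g e)"
proof -
  have eq: "a * b = rec_nat 0 (\<lambda>_ r. r + a) b" for a b :: nat by (induction b) auto
  have "comput (\<lambda>e. nfst e * nsnd e)" unfolding eq
    by (intro comput_rec comput_basic)
  then show ?thesis using assms by (rule comput_comp2)
qed

lemma comput_power: assumes "comput f" "comput g" shows "comput (\<lambda>e. f e ^ g e)"
proof -
  have eq: "a ^ b = rec_nat 1 (\<lambda>_ r. r * a) b" for a b :: nat by (induction b) auto
  have "comput (\<lambda>e. nfst e ^ nsnd e)" unfolding eq
    by (intro comput_rec comput_basic comput_mult)
  then show ?thesis using assms by (rule comput_comp2)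
qed

section \<open>Decidable and recursively enumerable predicates\<close>

definition decid :: "(nat \<Rightarrow> bool) \<Rightarrow> bool" where
  "decid P \<longleftrightarrow> comput (\<lambda>e. if P e then 1 else 0)"

lemma decid_comp: "decid P \<Longrightarrow> comput f \<Longrightarrow> decid (\<lambda>e. P (f e))"
  unfolding decid_def by (rule comput_comp)

lemma comput_if:
  assumes "decid P" "comput f" "comput g" shows "comput (\<lambda>e. if P e then f e else g e)"
proof -
  have eq: "(\<lambda>e. if P e then f e else g e) =
    (\<lambda>e. (if P e then 1 else 0) * f e + (1 - (if P e then 1 else 0)) * g e)" by auto
  show ?thesis unfolding eq using assms unfolding decid_def
    by (intro comput_basic comput_mult)
qed

lemma decid_const: "decid (\<lambda>e. c)"
  unfolding decid_def by (rule comput_const)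

lemma if_not: "(if \<not> b then x else y) = (if b then y else x)"
  by simp

lemma decid_not: "decid P \<Longrightarrow> decid (\<lambda>e. \<not> P e)"
  using comput_if[of P "\<lambda>e. 0" "\<lambda>e. 1"] unfolding decid_def
  by (simp add: comput_const if_not)

lemma decid_and: "decid P \<Longrightarrow> decid Q \<Longrightarrow> decid (\<lambda>e. P e \<and> Q e)"
proof -
  assume "decid P" "decid Q"
  moreover have "(if P e \<and> Q e then 1 else 0) = (if P e then if Q e then 1 else 0 else (0::nat))" for e
    by simp
  ultimately show ?thesis
    using comput_if[of P "\<lambda>e. if Q e then 1 else 0" "\<lambda>e. 0"] unfolding decid_def
    by (simp add: comput_const)
qed

lemma decid_or: "decid P \<Longrightarrow> decid Q \<Longrightarrow> decid (\<lambda>e. P e \<or> Q e)"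
  using decid_not[OF decid_and[OF decid_not decid_not], of P Q] by simp

lemma decid_imp: "decid P \<Longrightarrow> decid Q \<Longrightarrow> decid (\<lambda>e. P e \<longrightarrow> Q e)"
  using decid_or[OF decid_not, of P Q] by simp

lemma decid_le: "comput f \<Longrightarrow> comput g \<Longrightarrow> decid (\<lambda>e. f e \<le> g e)"
proof -
  assume "comput f" "comput g"
  then have "comput (\<lambda>e. 1 - (f e - g e))" by (intro comput_basic)
  moreover have "1 - (f e - g e) = (if f e \<le> g e then 1 else 0)" for e by auto
  ultimately show ?thesis unfolding decid_def by simp
qed

lemma decid_less: "comput f \<Longrightarrow> comput g \<Longrightarrow> decid (\<lambda>e. f e < g e)"
  using decid_le[of "\<lambda>e. Suc (f e)" g] by (simp add: comput_Suc Suc_le_eq)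

lemma decid_eq: "comput f \<Longrightarrow> comput g \<Longrightarrow> decid (\<lambda>e. f e = g e)"
  using decid_and[OF decid_le decid_le, of f g g f] by (simp add: eq_iff)

text \<open>The truth value is computed by a recursion that drops to 0 at the first counterexample
  and stays there.\<close>

lemma decid_all:
  assumes "comput n" "decid (\<lambda>e. P (nfst e) (nsnd e))"
  shows "decid (\<lambda>e. \<forall>i<n e. P e i)"
proof -
  have eq: "(if \<forall>i<m. P e i then 1 else 0) = rec_nat 1 (\<lambda>i r. if P e i then r else 0) m" for e m
    by (induction m) (auto simp: less_Suc_eq)
  have P': "decid (\<lambda>e. P (nfst (nfst e)) (nsnd (nfst e)))"
    by (rule decid_comp[OF assms(2) comput_nfst[OF comput_id]])
  then show ?thesis unfolding decid_def eq
    by (intro comput_rec comput_if comput_basic P' assms)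
qed

lemma decid_ex:
  assumes "comput n" "decid (\<lambda>e. P (nfst e) (nsnd e))"
  shows "decid (\<lambda>e. \<exists>i<n e. P e i)"
  using decid_not[OF decid_all[OF assms(1) decid_not[OF assms(2)]]] by simp

lemmas decid_intros = decid_const decid_not decid_and decid_or decid_imp decid_le decid_less
  decid_eq decid_all decid_ex

lemmas comput_intros = comput_basic comput_mult comput_power comput_if comput_rec

section \<open>Unbounded search\<close>

text \<open>Minimization of the characteristic function of the negation of \<open>P\<close>. Being
  an equivalence, the statement also covers divergence when no witness exists.\<close>

lemma rec_search:
  assumes "decid P"
  shows "\<exists>F. \<forall>x y. rec_eval F [x] y \<longleftrightarrow> P (npair x y) \<and> (\<forall>z<y. \<not> P (npair x z))"
proof -
  \<comment> \<open>\<open>Mn\<close> puts the candidate in front of the input, hence the swapped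
    pair.\<close>
  have "total_rec 2 (\<lambda>xs. npair (xs ! 1) (xs ! 0))"
    by (intro total_rec_npair total_rec_nth) auto
  from total_rec_comput[OF decid_not[OF assms, unfolded decid_def] this]
  obtain G where G: "\<And>xs. length xs = 2 \<Longrightarrow> rec_eval G xs (if \<not> P (npair (xs ! 1) (xs ! 0)) then 1 else 0)"
    unfolding total_rec_def by blast
  have "rec_eval G [y, x] (if \<not> P (npair x y) then 1 else 0)" for y x
    using G[of "[y, x]"] by simp
  then have G': "rec_eval G [y, x] v \<longleftrightarrow> v = (if \<not> P (npair x y) then 1 else 0)" for y x v
    using rec_eval_det by blast
  show ?thesis
  proof (intro exI[of _ "Mn G"] allI iffI)
    fix x y assume "rec_eval (Mn G) [x] y"
    then show "P (npair x y) \<and> (\<forall>z<y. \<not> P (npair x z))"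
      by cases (auto simp: G' split: if_splits)
  next
    fix x y assume "P (npair x y) \<and> (\<forall>z<y. \<not> P (npair x z))"
    then show "rec_eval (Mn G) [x] y" by (intro ev_Mn) (auto simp: G')
  qed
qed

text \<open>Search for the value, which exists because \<open>f\<close> is total. This handles
  functions such as division that are easier to characterize than to compute.\<close>

lemma comput_graph:
  assumes "decid (\<lambda>e. f (nfst e) = nsnd e)" shows "comput f"
proof -
  obtain F where F: "\<And>x y. rec_eval F [x] y \<longleftrightarrow> f x = y \<and> (\<forall>z<y. f x \<noteq> z)"
    using rec_search[OF assms] by auto
  have "rec_eval F [x] (f x)" for x by (simp add: F)
  then show ?thesis unfolding comput_def total_rec_def
    by (auto intro!: exI[of _ F] simp: length_Suc_conv)
qed

lemma comput_div: assumes "comput f" "comput g" shows "comput (\<lambda>e. f e div g e)"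
proof -
  have eq: "a div b = q \<longleftrightarrow> (b = 0 \<and> q = 0) \<or> (b \<noteq> 0 \<and> q * b \<le> a \<and> a < Suc q * b)" for a b q :: nat
    using dividend_less_div_times[of b a]
    by (cases "b = 0") (auto simp: div_nat_eqI mult.commute add.commute)
  have "comput (\<lambda>e. nfst e div nsnd e)"
    by (rule comput_graph, subst eq) (intro decid_intros comput_intros)
  then show ?thesis using assms by (rule comput_comp2)
qed

lemma comput_mod: assumes "comput f" "comput g" shows "comput (\<lambda>e. f e mod g e)"
  unfolding minus_div_mult_eq_mod[symmetric]
  by (intro comput_intros comput_div assms)

section \<open>Recursively enumerable predicates\<close>

definition recenum :: "(nat \<Rightarrow> bool) \<Rightarrow> bool" where
  "recenum P \<longleftrightarrow> (\<exists>Q. decid Q \<and> (\<forall>x. P x \<longleftrightarrow> (\<exists>t. Q (npair t x))))"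

lemma recenum_comp:
  assumes "recenum P" "comput f" shows "recenum (\<lambda>e. P (f e))"
proof -
  obtain Q where Q: "decid Q" "\<And>x. P x \<longleftrightarrow> (\<exists>t. Q (npair t x))"
    using assms unfolding recenum_def by blast
  have "decid (\<lambda>e. Q (npair (nfst e) (f (nsnd e))))"
    by (intro decid_comp[OF Q(1)] comput_intros comput_comp[OF assms(2)])
  then show ?thesis unfolding recenum_def Q(2)
    by (intro exI[of _ "\<lambda>e. Q (npair (nfst e) (f (nsnd e)))"]) auto
qed

lemma recenum_decid: "decid P \<Longrightarrow> recenum P"
  unfolding recenum_def
  using decid_comp[OF _ comput_nsnd[OF comput_id], of P]
  by (intro exI[of _ "\<lambda>e. P (nsnd e)"]) auto

lemma recenum_ex:
  assumes "recenum (\<lambda>e. P (nfst e) (nsnd e))" shows "recenum (\<lambda>e. \<exists>i. P e i)"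
proof -
  obtain Q where Q: "decid Q" "\<And>x. P (nfst x) (nsnd x) \<longleftrightarrow> (\<exists>t. Q (npair t x))"
    using assms unfolding recenum_def by blast
  \<comment> \<open>The two unbounded quantifiers are merged: the new witness is the pair of the old
    witness \<open>t\<close> and the value \<open>i\<close>.\<close>
  let ?R = "\<lambda>e. Q (npair (nfst (nfst e)) (npair (nsnd e) (nsnd (nfst e))))"
  have "decid ?R" by (intro decid_comp[OF Q(1)] comput_intros)
  moreover have "(\<exists>i. P x i) \<longleftrightarrow> (\<exists>t. ?R (npair t x))" for x
    using Q(2)[of "npair x _"] by (auto, metis nfst_npair nsnd_npair)
  ultimately show ?thesis unfolding recenum_def by blast
qed

lemma recenum_and:
  assumes "recenum P" "recenum P'" shows "recenum (\<lambda>e. P e \<and> P' e)"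
proof -
  obtain Q where Q: "decid Q" "\<And>x. P x \<longleftrightarrow> (\<exists>t. Q (npair t x))"
    using assms unfolding recenum_def by blast
  obtain Q' where Q': "decid Q'" "\<And>x. P' x \<longleftrightarrow> (\<exists>t. Q' (npair t x))"
    using assms unfolding recenum_def by blast
  have "recenum (\<lambda>e. \<exists>t. \<exists>t'. Q (npair t e) \<and> Q' (npair t' e))"
    by (intro recenum_ex recenum_decid decid_intros decid_comp[OF Q(1)] decid_comp[OF Q'(1)] comput_intros)
  then show ?thesis by (simp add: Q(2) Q'(2))
qed

text \<open>One more than the sum of the chosen witnesses exceeds each of them. This pulls an
  unbounded quantifier out of a bounded one, and later yields one time bound valid for all
  tables.\<close>

lemma bounded_collection:
  fixes n :: nat
  assumes "\<forall>i<n. \<exists>t::nat. Q i t" shows "\<exists>b. \<forall>i<n. \<exists>t<b. Q i t"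
proof -
  obtain t where "\<And>i. i < n \<Longrightarrow> Q i (t i)" using assms by metis
  moreover have "t i < Suc (\<Sum>i<n. t i)" if "i < n" for i
    using that by (auto simp: less_Suc_eq_le intro: member_le_sum)
  ultimately show ?thesis by blast
qed

lemma recenum_all:
  assumes "comput n" "recenum (\<lambda>e. P (nfst e) (nsnd e))" shows "recenum (\<lambda>e. \<forall>i<n e. P e i)"
proof -
  obtain Q where Q: "decid Q" "\<And>x. P (nfst x) (nsnd x) \<longleftrightarrow> (\<exists>t. Q (npair t x))"
    using assms unfolding recenum_def by blast
  have "recenum (\<lambda>e. \<exists>b. \<forall>i<n e. \<exists>t<b. Q (npair t (npair e i)))"
    by (intro recenum_ex recenum_decid decid_intros decid_comp[OF Q(1)] comput_intros comput_comp[OF assms(1)])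
  moreover have "(\<forall>i<n e. P e i) \<longleftrightarrow> (\<exists>b. \<forall>i<n e. \<exists>t<b. Q (npair t (npair e i)))" for e
    using bounded_collection[of "n e" "\<lambda>i t. Q (npair t (npair e i))"] Q(2)[of "npair e _"] by auto
  ultimately show ?thesis by simp
qed

lemmas recenum_intros = recenum_and recenum_ex recenum_all

section \<open>Graphs of partial recursive functions\<close>

text \<open>Access to the codes of \<open>list_encode\<close>, where 0 is the empty list and
  \<open>Suc (npair x c)\<close> a nonempty one; the subtraction strips the
  \<open>Suc\<close>.\<close>

definition nhd :: "nat \<Rightarrow> nat" where "nhd c = nfst (c - 1)"
definition ntl :: "nat \<Rightarrow> nat" where "ntl c = nsnd (c - 1)"
definition nnth :: "nat \<Rightarrow> nat \<Rightarrow> nat" where "nnth c i = nhd (rec_nat c (\<lambda>_. ntl) i)"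

lemma list_encode_Cons: "list_encode (x # xs) = Suc (npair x (list_encode xs))"
  by (simp add: npair_def)

lemma nhd_Cons [simp]: "nhd (list_encode (x # xs)) = x"
  and ntl_Cons [simp]: "ntl (list_encode (x # xs)) = list_encode xs"
  unfolding list_encode_Cons nhd_def ntl_def by simp_all

lemma ntl_0 [simp]: "ntl 0 = 0"
  by (simp add: ntl_def)

lemma list_decode_eq_Nil [simp]: "list_decode c = [] \<longleftrightarrow> c = 0"
  by (metis list_decode.simps(1) list_decode_inverse)

lemma list_decode_conv: "c \<noteq> 0 \<Longrightarrow> list_decode c = nhd c # list_decode (ntl c)"
  by (metis list_decode_eq_Nil list_decode_inverse list_encode_inverse neq_Nil_conv nhd_Cons ntl_Cons)

lemma list_decode_Cons [simp]: "list_decode (Suc (npair x c)) = x # list_decode c"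
  by (metis list_encode_Cons list_decode_inverse list_encode_inverse)

declare list_decode.simps(2) [simp del] list_encode.simps(2) [simp del]

lemma iterate_ntl: "rec_nat (list_encode xs) (\<lambda>_. ntl) i = list_encode (drop i xs)"
proof (induction i arbitrary: xs)
  case (Suc i)
  then show ?case
    using ntl_0 by (cases "drop i xs") (auto simp: drop_Suc tl_drop[symmetric] simp del: list_encode.simps(2))
qed simp

lemma nnth_list_encode: "i < length xs \<Longrightarrow> nnth (list_encode xs) i = xs ! i"
  unfolding nnth_def iterate_ntl by (simp only: Cons_nth_drop_Suc[symmetric] nhd_Cons)

lemma comput_nhd: "comput f \<Longrightarrow> comput (\<lambda>e. nhd (f e))"
  and comput_ntl: "comput f \<Longrightarrow> comput (\<lambda>e. ntl (f e))"
  unfolding nhd_def ntl_def by (intro comput_intros; assumption)+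

lemma comput_nnth:
  assumes "comput f" "comput g" shows "comput (\<lambda>e. nnth (f e) (g e))"
  unfolding nnth_def by (intro comput_nhd comput_rec comput_ntl comput_basic assms)

lemma rec_eval_Zr: "rec_eval Zr xs r \<longleftrightarrow> r = 0"
  by (auto intro: ev_Zr elim: rec_eval.cases)

lemma rec_eval_Sc: "rec_eval Sc xs r \<longleftrightarrow> (\<exists>x ys. xs = x # ys \<and> r = Suc x)"
  by (auto intro: ev_Sc elim: rec_eval.cases)

lemma rec_eval_Pj: "rec_eval (Pj i) xs r \<longleftrightarrow> i < length xs \<and> r = xs ! i"
  by (auto intro: ev_Pj elim: rec_eval.cases)

lemma rec_eval_Cn:
  "rec_eval (Cn g hs) xs r \<longleftrightarrow> (\<exists>ys. list_all2 (\<lambda>h y. rec_eval h xs y) hs ys \<and> rec_eval g ys r)"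
proof
  assume "rec_eval (Cn g hs) xs r"
  then show "\<exists>ys. list_all2 (\<lambda>h y. rec_eval h xs y) hs ys \<and> rec_eval g ys r"
    by cases (metis list_all2_conv_all_nth)
next
  assume "\<exists>ys. list_all2 (\<lambda>h y. rec_eval h xs y) hs ys \<and> rec_eval g ys r"
  then obtain ys where "list_all2 (\<lambda>h y. rec_eval h xs y) hs ys" "rec_eval g ys r" by blast
  then show "rec_eval (Cn g hs) xs r"
    by (intro ev_Cn[of ys]) (auto simp: list_all2_conv_all_nth)
qed

text \<open>The nested derivation is flattened into the sequence \<open>s\<close> of intermediate
  values, a finite part of which can be coded by a number.\<close>

lemma rec_eval_Pr:
  "rec_eval (Pr f g) (n # xs) r \<longleftrightarrow>
    (\<exists>s. rec_eval f xs (s 0) \<and> (\<forall>i<n. rec_eval g (i # s i # xs) (s (Suc i))) \<and> s n = r)"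
proof (induction n arbitrary: r)
  case 0
  have "rec_eval (Pr f g) (0 # xs) r \<longleftrightarrow> rec_eval f xs r"
    by (auto intro: ev_Pr0 elim: rec_eval.cases)
  then show ?case by auto
next
  case (Suc n)
  have "rec_eval (Pr f g) (Suc n # xs) r \<longleftrightarrow>
      (\<exists>q. rec_eval (Pr f g) (n # xs) q \<and> rec_eval g (n # q # xs) r)"
    by (auto intro: ev_PrS elim: rec_eval.cases)
  also have "\<dots> \<longleftrightarrow> (\<exists>s. rec_eval f xs (s 0) \<and>
      (\<forall>i<Suc n. rec_eval g (i # s i # xs) (s (Suc i))) \<and> s (Suc n) = r)" (is "?L = ?R")
  proof
    assume ?L
    then obtain s where s: "rec_eval f xs (s 0)" "\<forall>i<n. rec_eval g (i # s i # xs) (s (Suc i))"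
      "rec_eval g (n # s n # xs) r" unfolding Suc.IH by auto
    then show ?R by (intro exI[of _ "s(Suc n := r)"]) (auto simp: less_Suc_eq)
  next
    assume ?R
    then obtain s where "rec_eval f xs (s 0)"
      "\<forall>i<Suc n. rec_eval g (i # s i # xs) (s (Suc i))" "s (Suc n) = r" by blast
    then show ?L unfolding Suc.IH
      by (intro exI[of _ "s n"] conjI exI[of _ s]) auto
  qed
  finally show ?case .
qed

lemma rec_eval_Mn:
  "rec_eval (Mn f) xs n \<longleftrightarrow>
    rec_eval f (n # xs) 0 \<and> (\<forall>m<n. \<exists>v. 0 < v \<and> rec_eval f (m # xs) v)"
  by (auto intro: ev_Mn elim: rec_eval.cases)

lemma recenum_rec_eval_all2:
  assumes "\<And>h. h \<in> set hs \<Longrightarrow> recenum (\<lambda>e. rec_eval h (list_decode (nfst e)) (nsnd e))"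
  shows "recenum (\<lambda>e. list_all2 (\<lambda>h y. rec_eval h (list_decode (nfst e)) y) hs (list_decode (nsnd e)))"
  using assms
proof (induction hs)
  case Nil
  have "recenum (\<lambda>e. nsnd e = 0)" by (intro recenum_decid decid_intros comput_intros)
  then show ?case by simp
next
  case (Cons h hs)
  have "recenum (\<lambda>e. nsnd e \<noteq> 0 \<and> rec_eval h (list_decode (nfst (npair (nfst e) (nhd (nsnd e)))))
        (nsnd (npair (nfst e) (nhd (nsnd e)))) \<and>
      list_all2 (\<lambda>h y. rec_eval h (list_decode (nfst (npair (nfst e) (ntl (nsnd e))))) y) hs
        (list_decode (nsnd (npair (nfst e) (ntl (nsnd e))))))"
    using Cons.prems
    by (intro recenum_and recenum_comp[OF Cons.IH] recenum_comp[OF Cons.prems] recenum_decid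
        decid_intros comput_intros comput_nhd comput_ntl) auto
  moreover have "list_all2 (\<lambda>h y. rec_eval h (list_decode (nfst e)) y) (h # hs) (list_decode (nsnd e)) \<longleftrightarrow>
     nsnd e \<noteq> 0 \<and> rec_eval h (list_decode (nfst e)) (nhd (nsnd e)) \<and>
      list_all2 (\<lambda>h y. rec_eval h (list_decode (nfst e)) y) hs (list_decode (ntl (nsnd e)))" for e
    by (cases "nsnd e = 0") (auto simp: list_decode_conv)
  ultimately show ?case by simp
qed

text \<open>The program is fixed, so no universal function is needed.\<close>

lemma recenum_rec_eval: "recenum (\<lambda>e. rec_eval F (list_decode (nfst e)) (nsnd e))"
proof (induction F)
  case Zr
  show ?case unfolding rec_eval_Zr by (intro recenum_decid decid_intros comput_intros)
next
  case Sc
  have "rec_eval Sc (list_decode c) r \<longleftrightarrow> c \<noteq> 0 \<and> r = Suc (nhd c)" for c r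
    by (cases "c = 0") (auto simp: rec_eval_Sc list_decode_conv)
  then show ?case by simp (intro recenum_decid decid_intros comput_intros comput_nhd)
next
  case (Pj i)
  \<comment> \<open>The index is in range exactly when the code left after \<open>i\<close> tails is
    nonzero.\<close>
  have "rec_eval (Pj i) (list_decode c) r \<longleftrightarrow> rec_nat c (\<lambda>_. ntl) i \<noteq> 0 \<and> r = nnth c i" for c r
  proof -
    have "rec_nat c (\<lambda>_. ntl) i = 0 \<longleftrightarrow> list_decode (rec_nat c (\<lambda>_. ntl) i) = []" by simp
    also have "\<dots> \<longleftrightarrow> \<not> i < length (list_decode c)"
      using iterate_ntl[of "list_decode c" i] by (simp add: not_less del: list_decode_eq_Nil)
    finally show ?thesis
      using nnth_list_encode[of i "list_decode c"] by (auto simp: rec_eval_Pj)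
  qed
  then show ?case
    by simp (intro recenum_decid decid_intros comput_intros comput_nnth comput_ntl)
next
  case (Cn g hs)
  let ?p = "\<lambda>e. npair (nfst (nfst e)) (nsnd e)"
  let ?q = "\<lambda>e. npair (nsnd e) (nsnd (nfst e))"
  have "recenum (\<lambda>e. list_all2 (\<lambda>h y. rec_eval h (list_decode (nfst (?p e))) y) hs (list_decode (nsnd (?p e))) \<and>
      rec_eval g (list_decode (nfst (?q e))) (nsnd (?q e)))"
    using Cn.IH(2)
    by (intro recenum_and recenum_comp[OF recenum_rec_eval_all2] recenum_comp[OF Cn.IH(1)] comput_intros) auto
  then have "recenum (\<lambda>e. \<exists>c. list_all2 (\<lambda>h y. rec_eval h (list_decode (nfst e)) y) hs (list_decode c) \<and>
      rec_eval g (list_decode c) (nsnd e))"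
    by (intro recenum_ex) simp
  moreover have "(\<exists>ys. Q ys) \<longleftrightarrow> (\<exists>c. Q (list_decode c))" for Q
    by (metis list_encode_inverse)
  ultimately show ?case unfolding rec_eval_Cn by simp
next
  case (Pr f g)
  let ?n = "\<lambda>e. nhd (nfst e)" and ?x = "\<lambda>e. ntl (nfst e)"
  \<comment> \<open>The number \<open>w\<close> codes the list of intermediate values. The seemingly
    redundant pairings put each evaluation into the form of the induction hypotheses; the same is
    done for \<open>Mn\<close>.\<close>
  have eq: "rec_eval (Pr f g) (list_decode (nfst e)) (nsnd e) \<longleftrightarrow> nfst e \<noteq> 0 \<and>
     (\<exists>w. rec_eval f (list_decode (nfst (npair (?x e) (nnth w 0)))) (nsnd (npair (?x e) (nnth w 0))) \<and>
     (\<forall>i<?n e. rec_eval g (list_decode (nfst (npair (Suc (npair i (Suc (npair (nnth w i) (?x e))))) (nnth w (Suc i)))))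
        (nsnd (npair (Suc (npair i (Suc (npair (nnth w i) (?x e))))) (nnth w (Suc i))))) \<and>
     nnth w (?n e) = nsnd e)" (is "?L \<longleftrightarrow> nfst e \<noteq> 0 \<and> ?R") for e
  proof (cases "nfst e = 0")
    case True
    then show ?thesis by (auto elim: rec_eval.cases)
  next
    case False
    have "?L \<longleftrightarrow> (\<exists>s. rec_eval f (list_decode (?x e)) (s 0) \<and>
       (\<forall>i<?n e. rec_eval g (i # s i # list_decode (?x e)) (s (Suc i))) \<and> s (?n e) = nsnd e)"
      by (simp add: list_decode_conv[OF False] rec_eval_Pr)
    also have "\<dots> \<longleftrightarrow> ?R"
    proof
      assume "\<exists>s. rec_eval f (list_decode (?x e)) (s 0) \<and>
       (\<forall>i<?n e. rec_eval g (i # s i # list_decode (?x e)) (s (Suc i))) \<and> s (?n e) = nsnd e"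
      then obtain s where s: "rec_eval f (list_decode (?x e)) (s 0)"
        "\<forall>i<?n e. rec_eval g (i # s i # list_decode (?x e)) (s (Suc i))" "s (?n e) = nsnd e" by blast
      \<comment> \<open>With \<open>?n e\<close> recursion steps there are \<open>Suc (?n e)\<close>
        values to store, the initial one included.\<close>
      have "nnth (list_encode (map s [0..<Suc (?n e)])) i = s i" if "i \<le> ?n e" for i
        using that by (subst nnth_list_encode) (auto simp del: upt_Suc)
      then show ?R
        using s by (intro exI[of _ "list_encode (map s [0..<Suc (?n e)])"]) (simp del: upt_Suc)
    next
      assume ?R
      then obtain w where "rec_eval f (list_decode (?x e)) (nnth w 0)"
        "\<forall>i<?n e. rec_eval g (i # nnth w i # list_decode (?x e)) (nnth w (Suc i))"
        "nnth w (?n e) = nsnd e" by auto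
      then show "\<exists>s. rec_eval f (list_decode (?x e)) (s 0) \<and>
       (\<forall>i<?n e. rec_eval g (i # s i # list_decode (?x e)) (s (Suc i))) \<and> s (?n e) = nsnd e"
        by blast
    qed
    finally show ?thesis using False by simp
  qed
  show ?case unfolding eq
    by (intro recenum_intros recenum_comp[OF Pr.IH(1)] recenum_comp[OF Pr.IH(2)] recenum_decid
        decid_eq decid_not comput_basic comput_nnth comput_nhd comput_ntl)
next
  case (Mn f)
  have eq: "rec_eval (Mn f) (list_decode (nfst e)) (nsnd e) \<longleftrightarrow>
     rec_eval f (list_decode (nfst (npair (Suc (npair (nsnd e) (nfst e))) 0)))
       (nsnd (npair (Suc (npair (nsnd e) (nfst e))) 0)) \<and>
     (\<forall>m<nsnd e. \<exists>v. 0 < v \<and> rec_eval f (list_decode (nfst (npair (Suc (npair m (nfst e))) v)))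
       (nsnd (npair (Suc (npair m (nfst e))) v)))" for e
    unfolding rec_eval_Mn by simp
  show ?case unfolding eq
    by (intro recenum_intros recenum_comp[OF Mn.IH] recenum_decid decid_less comput_basic)
qed

section \<open>Strings and tables as numbers\<close>

lemma str_num_append: "str_num (x @ y) = str_num x + 2 ^ length x * str_num y"
  by (induction x) auto

lemma str_num_bounds: "2 ^ length x \<le> Suc (str_num x)" "str_num x + 2 \<le> 2 ^ Suc (length x)"
  by (induction x) auto

lemma inj_str_num: "inj str_num"
proof (rule injI)
  fix x y show "str_num x = str_num y \<Longrightarrow> x = y"
  proof (induction x arbitrary: y)
    case Nil then show ?case by (cases y) (auto split: if_splits)
  next
    case (Cons b x)
    then obtain c z where y: "y = c # z" by (cases y) (auto split: if_splits)
    have "b = c" using Cons.prems unfolding y by (cases b; cases c; simp) presburger+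
    then show ?case using Cons unfolding y by simp
  qed
qed

lemma surj_str_num: "\<exists>x. str_num x = n"
proof (induction n rule: less_induct)
  case (less n)
  show ?case
  proof (cases "n = 0")
    case True then show ?thesis by (intro exI[of _ "[]"]) simp
  next
    case False
    then obtain x where x: "str_num x = (n - 1) div 2" using less[of "(n - 1) div 2"] False by force
    show ?thesis
      \<comment> \<open>\<open>True\<close> is the digit 2 and \<open>False\<close> the digit 1, so
        the parity of \<open>n\<close> reveals the first bit and \<open>(n - 1) div 2\<close> is the
        number of the rest.\<close>
      using False by (intro exI[of _ "even n # x"]) (auto simp: x elim!: evenE oddE)
  qed
qed

definition num_str :: "nat \<Rightarrow> bool list" where "num_str = inv str_num"

lemma str_num_num_str [simp]: "str_num (num_str n) = n"
proof -
  have "n \<in> range str_num" using surj_str_num[of n] by (metis rangeI)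
  then show ?thesis unfolding num_str_def by (rule f_inv_into_f)
qed

lemma num_str_str_num [simp]: "num_str (str_num x) = x"
  unfolding num_str_def by (simp add: inj_str_num)

lemma str_num_eq_iff [simp]: "str_num x = str_num y \<longleftrightarrow> x = y"
  using inj_str_num by (auto dest: injD)

text \<open>Turns quantifiers over strings of bounded length, whether arguments, values or programs,
  into bounded numerical ones.\<close>

lemma length_le_iff: "length x \<le> N \<longleftrightarrow> str_num x < 2 ^ Suc N - 1"
proof
  assume "length x \<le> N"
  then have "(2::nat) ^ Suc (length x) \<le> 2 ^ Suc N" by (intro power_increasing) auto
  then show "str_num x < 2 ^ Suc N - 1" using str_num_bounds(2)[of x] by linarith
next
  assume "str_num x < 2 ^ Suc N - 1"
  then have "(2::nat) ^ length x < 2 ^ Suc N" using str_num_bounds(1)[of x] by linarith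
  then show "length x \<le> N" by (metis less_Suc_eq_le nat_power_less_imp_less pos2)
qed

text \<open>After reversal the leading bit is the most significant digit: prefixing
  \<open>False\<close> shifts all numbers by \<open>2 ^ n\<close>, prefixing \<open>True\<close> by
  twice that, and the two shifted intervals are adjacent.\<close>

lemma str_num_rev_strs_len: "map (\<lambda>x. str_num (rev x)) (strs_len n) = [2 ^ n - 1..<2 ^ Suc n - 1]"
  and length_strs_len: "x \<in> set (strs_len n) \<Longrightarrow> length x = n"
proof (induction n arbitrary: x)
  case (Suc n)
  case 1
  have *: "map (\<lambda>x. str_num (rev (b # x))) (strs_len n) =
     map (\<lambda>i. i + 2 ^ n * (if b then 2 else 1)) (map (\<lambda>x. str_num (rev x)) (strs_len n))" for b
    using Suc(2) by (auto simp: str_num_append)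
  have **: "map (\<lambda>i. i + k) [a..<b] = [a + k..<b + k]" for a b k :: nat
    by (induction b) auto
  have "[2 ^ Suc n - 1..<2 ^ Suc (Suc n) - 1] =
    [2 ^ n - 1 + 2 ^ n..<2 ^ Suc n - 1 + 2 ^ n] @ [2 ^ n - 1 + 2 ^ n * 2..<2 ^ Suc n - 1 + 2 ^ n * (2::nat)]"
  proof -
    have "2 ^ Suc n - 1 = 2 ^ n - 1 + (2::nat) ^ n" "2 ^ n - 1 + 2 ^ n * 2 = 2 ^ Suc n - 1 + (2::nat) ^ n"
      "2 ^ Suc (Suc n) - 1 = 2 ^ Suc n - 1 + 2 ^ n + (2::nat) ^ n"
      "2 ^ Suc n - 1 + 2 ^ n * 2 = 2 ^ Suc n - 1 + 2 ^ n + (2::nat) ^ n"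
      by simp_all
    then show ?thesis
      using upt_add_eq_append[of "2 ^ n - 1 + 2 ^ n" "2 ^ Suc n - 1 + 2 ^ n" "(2::nat) ^ n"] by (simp only: le_add1)
  qed
  then show ?case using *[of False] *[of True] ** unfolding Suc(1)
    by (simp add: comp_def del: upt_Suc)
  case 2
  then show ?case using Suc(2) by auto
qed auto

text \<open>The enumeration is lexicographic with the first bit most significant, whereas
  \<^const>\<open>str_num\<close> makes the first bit least significant; hence the reversal.\<close>

lemma strs_upto_eq: "strs_upto N = map (\<lambda>i. rev (num_str i)) [0..<2 ^ Suc N - 1]"
proof -
  have "map (\<lambda>x. str_num (rev x)) (strs_upto N) = [0..<2 ^ Suc N - 1]"
  proof (induction N)
    case (Suc N)
    have "[0..<2 ^ Suc (Suc N) - 1] = [0..<2 ^ Suc N - 1] @ [2 ^ Suc N - 1..<2 ^ Suc (Suc N) - (1::nat)]"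
      using upt_add_eq_append[of 0 "2 ^ Suc N - 1" "2 ^ Suc N"] by (simp add: algebra_simps)
    then show ?case using Suc str_num_rev_strs_len[of "Suc N"] by (simp add: strs_upto_def del: strs_len.simps power_Suc)
  qed (simp add: strs_upto_def)
  from arg_cong[OF this, of "map (\<lambda>i. rev (num_str i))"] show ?thesis by (simp add: comp_def)
qed

text \<open>Left fold over the bijective binary digits of \<open>n\<close>, first bit first. The
  state pairs the accumulator with the digits still unread; \<open>2 - n mod 2\<close> is the next
  digit. A string is no longer than its number, so \<open>n\<close> rounds suffice, and the state is
  stationary once all digits are read.\<close>

definition str_fold :: "(nat \<Rightarrow> nat \<Rightarrow> nat) \<Rightarrow> nat \<Rightarrow> nat \<Rightarrow> nat" where
  "str_fold h a n = nfst (rec_nat (npair a n)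
     (\<lambda>_ s. if nsnd s = 0 then s else npair (h (nfst s) (2 - nsnd s mod 2)) ((nsnd s - 1) div 2)) n)"

lemma str_fold_str_num:
  "str_fold h a (str_num x) = foldl (\<lambda>r b. h r (if b then 2 else 1)) a x"
proof -
  define f where "f = (\<lambda>s. if nsnd s = 0 then s else npair (h (nfst s) (2 - nsnd s mod 2)) ((nsnd s - 1) div 2))"
  have f0: "(f ^^ k) (npair a 0) = npair a 0" for k a by (induction k) (auto simp: f_def)
  have iter: "rec_nat s (\<lambda>_. f) k = (f ^^ k) s" for s k by (induction k) auto
  have "length x \<le> k \<Longrightarrow> (f ^^ k) (npair a (str_num x)) = npair (foldl (\<lambda>r b. h r (if b then 2 else 1)) a x) 0" for k
  proof (induction x arbitrary: a k)
    case Nil then show ?case by (simp add: f0)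
  next
    case (Cons b x)
    then obtain k' where k: "k = Suc k'" by (cases k) auto
    have "f (npair a (str_num (b # x))) = npair (h a (if b then 2 else 1)) (str_num x)"
      by (auto simp: f_def mod_Suc)
    moreover have "(f ^^ k) s = (f ^^ k') (f s)" for s by (simp add: k funpow_swap1)
    ultimately show ?case using Cons by (simp add: k del: str_num.simps funpow.simps)
  qed
  moreover have "length x \<le> str_num x" by (induction x) auto
  ultimately show ?thesis unfolding str_fold_def f_def[symmetric] iter by simp
qed

lemma comput_str_fold:
  assumes h: "comput (\<lambda>e. h (nfst e) (nsnd e))" and "comput a" "comput n"
  shows "comput (\<lambda>e. str_fold h (a e) (n e))"
  unfolding str_fold_def
  by (intro comput_intros decid_intros comput_comp2[OF h] comput_div comput_mod assms(2,3))

text \<open>\<open>2 * r + d\<close> is the number of the string \<open>r\<close> with the digit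
  \<open>d\<close> put in front.\<close>

definition str_rev :: "nat \<Rightarrow> nat" where
  "str_rev n = str_fold (\<lambda>r d. 2 * r + d) 0 n"

lemma str_rev_str_num [simp]: "str_rev (str_num x) = str_num (rev x)"
proof -
  have "foldl (\<lambda>r b. 2 * r + (if b then 2 else 1)) (str_num y) x = str_num (rev x @ y)" for y
    by (induction x arbitrary: y) (auto simp flip: str_num.simps)
  from this[of "[]"] show ?thesis by (simp add: str_rev_def str_fold_str_num)
qed

lemma comput_str_rev: "comput f \<Longrightarrow> comput (\<lambda>e. str_rev (f e))"
  unfolding str_rev_def by (intro comput_str_fold comput_intros)

text \<open>\<open>4 * r + 5\<close> is the number of \<open>r\<close> preceded by the end marker
  01, and \<open>4 * r + 3 * d\<close> that of \<open>r\<close> preceded by a doubled digit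
  \<open>d\<close>. Digits are prepended, hence the initial reversal.\<close>

definition sd_app :: "nat \<Rightarrow> nat \<Rightarrow> nat" where
  "sd_app n r = str_fold (\<lambda>r d. 4 * r + 3 * d) (4 * r + 5) (str_rev n)"

lemma sd_app_str_num [simp]: "sd_app (str_num x) (str_num y) = str_num (sd_code x @ y)"
proof -
  have "foldr (\<lambda>b r. 4 * r + 3 * (if b then 2 else 1)) x (str_num z) = str_num (concat (map (\<lambda>b. [b, b]) x) @ z)" for z
    by (induction x) auto
  moreover have "str_num (False # True # y) = 4 * str_num y + 5" by simp
  ultimately have
    "foldr (\<lambda>b r. 4 * r + 3 * (if b then 2 else 1)) x (4 * str_num y + 5) = str_num (sd_code x @ y)"
    by (metis sd_code_def append.assoc append_Cons append_Nil)
  then show ?thesis by (simp add: sd_app_def str_fold_str_num foldl_conv_foldr)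
qed

lemma comput_sd_app: "comput f \<Longrightarrow> comput g \<Longrightarrow> comput (\<lambda>e. sd_app (f e) (g e))"
  unfolding sd_app_def by (intro comput_str_fold comput_str_rev comput_intros)

text \<open>Read in blocks of two bits, a block of equal bits belongs to the string and the first
  block 01 ends it, so the code is prefix-free.\<close>

lemma sd_code_append_eq: "sd_code x @ u = sd_code y @ v \<longleftrightarrow> x = y \<and> u = v"
proof (induction x arbitrary: y)
  case Nil show ?case by (cases y) (auto simp: sd_code_def)
next
  case (Cons b x)
  then show ?case by (cases y) (auto simp: sd_code_def)
qed

lemma concat_sd_code_inj: "concat (map sd_code xs) = concat (map sd_code ys) \<Longrightarrow> xs = ys"
proof (induction xs arbitrary: ys)
  case Nil then show ?case by (cases ys) (auto simp: sd_code_def)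
next
  case (Cons x xs)
  then show ?case by (cases ys) (auto simp: sd_code_append_eq, auto simp: sd_code_def)
qed

section \<open>Tables as digit expansions\<close>

text \<open>A function on \<^term>\<open>{..<B}\<close> with values in \<^term>\<open>{..<B}\<close> is coded by the number below
  \<^term>\<open>B ^ B\<close> whose base-\<^term>\<open>B\<close> digits are its values.\<close>

definition digit :: "nat \<Rightarrow> nat \<Rightarrow> nat \<Rightarrow> nat" where
  "digit B c i = c div B ^ i mod B"

lemma comput_digit:
  "comput f \<Longrightarrow> comput g \<Longrightarrow> comput h \<Longrightarrow> comput (\<lambda>e. digit (f e) (g e) (h e))"
  unfolding digit_def by (intro comput_div comput_mod comput_intros)

lemma digits_exist:
  assumes "\<And>i. i < n \<Longrightarrow> v i < B" shows "\<exists>c<B ^ n. \<forall>i<n. digit B c i = v i"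
  using assms
proof (induction n arbitrary: v)
  case (Suc n)
  obtain c where c: "c < B ^ n" "\<And>i. i < n \<Longrightarrow> digit B c i = v (Suc i)"
    using Suc.IH[of "\<lambda>i. v (Suc i)"] Suc.prems by auto
  have v0: "v 0 < B" using Suc.prems by simp
  \<comment> \<open>Horner's scheme: \<open>v 0\<close> becomes the lowest digit and the digits of
    \<open>c\<close> move up by one place.\<close>
  have "c * B + v 0 < Suc c * B" using v0 by simp
  also have "\<dots> \<le> B ^ n * B" using c(1) by (intro mult_right_mono) auto
  finally have "c * B + v 0 < B ^ Suc n" by (simp add: mult.commute)
  moreover have "digit B (c * B + v 0) i = v i" if "i < Suc n" for i
    using that v0 c(2) by (cases i) (auto simp: digit_def div_mult2_eq)
  ultimately show ?case by blast
qed simp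

text \<open>The table string with the digits of \<open>c\<close> as entries. Entries are prepended,
  so the recursion visits the positions from \<open>B - 1\<close> down to 0.\<close>

definition num_table :: "nat \<Rightarrow> nat \<Rightarrow> nat" where
  "num_table B c = rec_nat 0 (\<lambda>k r. sd_app (digit B c (B - 1 - k)) r) B"

lemma comput_num_table: "comput f \<Longrightarrow> comput g \<Longrightarrow> comput (\<lambda>e. num_table (f e) (g e))"
  unfolding num_table_def
  by (intro comput_rec comput_sd_app comput_digit comput_basic; (rule comput_comp[of f] comput_comp[of g])?; (assumption | intro comput_basic))

lemma num_table_eq:
  "num_table B c = str_num (concat (map (\<lambda>i. sd_code (num_str (digit B c i))) [0..<B]))"
proof -
  have "k \<le> B \<Longrightarrow> rec_nat 0 (\<lambda>k r. sd_app (digit B c (B - 1 - k)) r) k =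
    str_num (concat (map (\<lambda>i. sd_code (num_str (digit B c i))) [B - k..<B]))" for k
  proof (induction k)
    case (Suc k)
    have "sd_app (digit B c (B - Suc k)) (str_num y) = str_num (sd_code (num_str (digit B c (B - Suc k))) @ y)" for y
      using sd_app_str_num[of "num_str (digit B c (B - Suc k))" y] by simp
    moreover have "[B - Suc k..<B] = (B - Suc k) # [B - k..<B]"
      using Suc.prems by (simp add: upt_conv_Cons Suc_diff_Suc)
    ultimately show ?case using Suc by simp
  qed simp
  from this[of B] show ?thesis by (simp add: num_table_def)
qed

lemma table_code_eq:
  "table_code N f = concat (map (\<lambda>i. sd_code (f (rev (num_str i)))) [0..<2 ^ Suc N - 1])"
  unfolding table_code_def strs_upto_eq by (simp add: comp_def)

lemma recenum_comp3:
  assumes "recenum (\<lambda>e. G (nfst (nfst e)) (nsnd (nfst e)) (nsnd e))"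
    and "comput f" "comput g" "comput h"
  shows "recenum (\<lambda>e. G (f e) (g e) (h e))"
  using recenum_comp[OF assms(1), of "\<lambda>e. npair (npair (f e) (g e)) (h e)"] assms(2-4)
  by (simp add: comput_npair)

section \<open>Machines\<close>

text \<open>Search for the least pair of a witness and an output, then project to the output. By
  \<open>func\<close> any output found in this way is the intended one.\<close>

lemma computable2I:
  assumes "recenum (\<lambda>e. G (nfst (nfst e)) (nsnd (nfst e)) (nsnd e))"
    and "\<And>p y x. D p y = Some x \<longleftrightarrow> G (str_num p) (str_num y) (str_num x)"
    and func: "\<And>p y x x'. G p y x \<Longrightarrow> G p y x' \<Longrightarrow> x = x'"
  shows "computable2 D"
proof -
  obtain Q where Q: "decid Q" "\<And>x. G (nfst (nfst x)) (nsnd (nfst x)) (nsnd x) \<longleftrightarrow> (\<exists>t. Q (npair t x))"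
    using assms unfolding recenum_def by blast
  have "decid (\<lambda>e. Q (npair (nfst (nsnd e)) (npair (nfst e) (nsnd (nsnd e)))))"
    by (intro decid_comp[OF Q(1)] comput_intros)
  from rec_search[OF this] obtain S where
    S: "\<And>x y. rec_eval S [x] y \<longleftrightarrow> Q (npair (nfst y) (npair x (nsnd y))) \<and>
       (\<forall>z<y. \<not> Q (npair (nfst z) (npair x (nsnd z))))" by auto
  obtain A where A: "\<And>x. rec_eval A [x] (nsnd x)"
    using comput_nsnd[OF comput_id] unfolding comput_def total_rec_def by (metis length_Cons list.size(3) nth_Cons_0 One_nat_def)
  have A': "rec_eval A [x] v \<longleftrightarrow> v = nsnd x" for x v using A rec_eval_det by blast
  have "total_rec 2 (\<lambda>xs. npair (xs ! 0) (xs ! 1))"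
    by (intro total_rec_npair total_rec_nth) auto
  then obtain B where B: "\<And>xs. length xs = 2 \<Longrightarrow> rec_eval B xs (npair (xs ! 0) (xs ! 1))"
    unfolding total_rec_def by blast
  have B': "rec_eval B [p, y] v \<longleftrightarrow> v = npair p y" for p y v
    using B[of "[p, y]"] rec_eval_det by fastforce
  \<comment> \<open>\<open>B\<close> packs the two inputs, \<open>S\<close> searches,
    \<open>A\<close> extracts the output.\<close>
  let ?F = "Cn A [Cn S [B]]"
  have one: "rec_eval (Cn f [g]) xs r \<longleftrightarrow> (\<exists>y. rec_eval g xs y \<and> rec_eval f [y] r)" for f g xs r
  proof
    assume "rec_eval (Cn f [g]) xs r"
    then show "\<exists>y. rec_eval g xs y \<and> rec_eval f [y] r"
      by cases (auto simp: length_Suc_conv)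
  next
    assume "\<exists>y. rec_eval g xs y \<and> rec_eval f [y] r"
    then obtain y where "rec_eval g xs y" "rec_eval f [y] r" by blast
    then show "rec_eval (Cn f [g]) xs r" by (intro ev_Cn[of "[y]"]) auto
  qed
  have "rec_eval ?F [p, y] x \<longleftrightarrow> G p y x" for p y x
  proof
    assume "rec_eval ?F [p, y] x"
    then obtain w where "rec_eval S [npair p y] w" "x = nsnd w" by (auto simp: one A' B')
    then have "\<exists>t. Q (npair t (npair (npair p y) x))" unfolding S by blast
    then show "G p y x" using Q(2)[of "npair (npair p y) x"] by simp
  next
    assume g: "G p y x"
    let ?R = "\<lambda>w. Q (npair (nfst w) (npair (npair p y) (nsnd w)))"
    obtain t where "Q (npair t (npair (npair p y) x))"
      using g Q(2)[of "npair (npair p y) x"] by auto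
    then have "?R (npair t x)" by simp
    then have least: "?R (LEAST w. ?R w)" by (rule LeastI)
    moreover have "\<forall>z<(LEAST w. ?R w). \<not> ?R z" by (meson not_less_Least)
    ultimately have "rec_eval S [npair p y] (LEAST w. ?R w)" unfolding S by blast
    moreover have "G p y (nsnd (LEAST w. ?R w))"
      using least Q(2)[of "npair (npair p y) (nsnd (LEAST w. ?R w))"] by auto
    then have "nsnd (LEAST w. ?R w) = x" using g func by blast
    ultimately show "rec_eval ?F [p, y] x" by (auto simp: one A' B')
  qed
  then show ?thesis unfolding computable2_def assms(2) by blast
qed

text \<open>The source of all upper bounds on complexity: a single-valued recursively enumerable
  relation is a description method, which \<open>U\<close> simulates at constant cost.\<close>

lemma optimal_simulates:
  assumes U: "optimal U"
    and G: "recenum (\<lambda>e. G (nfst (nfst e)) (nsnd (nfst e)) (nsnd e))"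
    and func: "\<And>p y x x'. G p y x \<Longrightarrow> G p y x' \<Longrightarrow> x = x'"
  shows "\<exists>c. \<forall>p y x. G (str_num p) (str_num y) (str_num x) \<longrightarrow> KSc U x y \<le> length p + c"
proof -
  define D where "D p y = (if \<exists>x. G (str_num p) (str_num y) (str_num x)
    then Some (THE x. G (str_num p) (str_num y) (str_num x)) else None)" for p y
  have D: "D p y = Some x \<longleftrightarrow> G (str_num p) (str_num y) (str_num x)" for p y x
  proof -
    have "(THE x. G (str_num p) (str_num y) (str_num x)) = z"
      if "G (str_num p) (str_num y) (str_num z)" for z
      using that func by (intro the_equality) (auto dest: func[OF that])
    then show ?thesis unfolding D_def by auto
  qed
  have "computable2 D"
    by (rule computable2I[OF G D func])
  then obtain c where c: "\<And>p y x. D p y = Some x \<Longrightarrow> \<exists>q. U q y = Some x \<and> length q \<le> length p + c"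
    using U unfolding optimal_def by metis
  have "KSc U x y \<le> length p + c" if g: "G (str_num p) (str_num y) (str_num x)" for p y x
  proof -
    obtain q where q: "U q y = Some x" "length q \<le> length p + c" using c g D by blast
    have "KSc U x y \<le> length q" unfolding KSc_def by (rule Least_le) (use q in blast)
    then show ?thesis using q by simp
  qed
  then show ?thesis by blast
qed

text \<open>The minimum is taken over a nonempty set, because the machine that outputs its own
  program is simulated by \<open>U\<close>.\<close>

lemma KSc_attained:
  assumes "optimal U" shows "\<exists>p. length p = KSc U x y \<and> U p y = Some x"
proof -
  have "computable2 (\<lambda>p y. Some p)"
  proof (rule computable2I[where G = "\<lambda>p y x. x = p"])
    show "recenum (\<lambda>e. nsnd e = nfst (nfst e))" by (intro recenum_decid decid_eq comput_intros)
  qed auto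
  then obtain q where "U q y = Some x" using assms unfolding optimal_def by metis
  then have "\<exists>p. length p = length q \<and> U p y = Some x" by blast
  then show ?thesis unfolding KSc_def by (rule LeastI)
qed

lemma optimal_graph:
  assumes "optimal U"
  shows "recenum (\<lambda>e. U (num_str (nfst (nfst e))) (num_str (nsnd (nfst e))) = Some (num_str (nsnd e)))"
proof -
  obtain F where F: "\<And>p y x. U p y = Some x \<longleftrightarrow> rec_eval F [str_num p, str_num y] (str_num x)"
    using assms unfolding optimal_def computable2_def by blast
  have "recenum (\<lambda>e. rec_eval F (list_decode (nfst (npair (Suc (npair (nfst (nfst e))
      (Suc (npair (nsnd (nfst e)) 0)))) (nsnd e))))
      (nsnd (npair (Suc (npair (nfst (nfst e)) (Suc (npair (nsnd (nfst e)) 0)))) (nsnd e))))"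
    by (intro recenum_comp[OF recenum_rec_eval] comput_intros)
  then show ?thesis by (simp add: F)
qed

lemma str_rev_str_rev [simp]: "str_rev (str_rev n) = n"
  using str_rev_str_num[of "num_str n"] str_rev_str_num[of "rev (num_str n)"] by simp

text \<open>The number of strings of length at most \<open>N\<close>: both the number of entries of
  a table and the strict bound on the numbers of its values.\<close>

definition nstrs :: "nat \<Rightarrow> nat" where "nstrs N = 2 ^ Suc N - 1"

lemma nstrs_pos [simp]: "0 < nstrs N"
  unfolding nstrs_def using length_le_iff[of "[]" N] by simp

lemma length_le_nstrs: "length x \<le> N \<longleftrightarrow> str_num x < nstrs N"
  unfolding nstrs_def by (rule length_le_iff)

lemma str_rev_less: "n < nstrs N \<Longrightarrow> str_rev n < nstrs N"
  using length_le_nstrs[of "num_str n" N] length_le_nstrs[of "rev (num_str n)" N] str_rev_str_num[of "num_str n"]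
  by simp

text \<open>Every \<open>c\<close> codes the table of some function. The entry for \<open>x\<close>
  is at position \<open>str_num (rev x)\<close>, since tables list the arguments lexicographically
  within each length.\<close>

lemma num_table_nstrs:
  "num_table (nstrs N) c = str_num (table_code N (\<lambda>x. num_str (digit (nstrs N) c (str_num (rev x)))))"
  unfolding num_table_eq table_code_eq nstrs_def by simp

text \<open>Conversely, every admissible table has a code; the bound on \<open>c\<close> makes
  quantification over tables a bounded one.\<close>

lemma table_code_num_table:
  assumes "\<And>x. length x \<le> N \<Longrightarrow> length (f x) \<le> N"
  obtains c where "c < nstrs N ^ nstrs N" "str_num (table_code N f) = num_table (nstrs N) c"
    "\<And>x. length x \<le> N \<Longrightarrow> digit (nstrs N) c (str_num (rev x)) = str_num (f x)"
proof -
  have v: "str_num (f (rev (num_str i))) < nstrs N" if "i < nstrs N" for i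
    using assms[of "rev (num_str i)"] that by (simp add: length_le_nstrs[of "num_str i"] length_le_nstrs[of "f _"])
  obtain c where c: "c < nstrs N ^ nstrs N"
    "\<And>i. i < nstrs N \<Longrightarrow> digit (nstrs N) c i = str_num (f (rev (num_str i)))"
    using digits_exist[of "nstrs N" "\<lambda>i. str_num (f (rev (num_str i)))" "nstrs N"] v by auto
  show ?thesis
  proof (rule that[OF c(1)])
    show "str_num (table_code N f) = num_table (nstrs N) c"
      unfolding num_table_eq table_code_eq nstrs_def[symmetric] using c(2)
      by (auto intro!: arg_cong[where f = concat])
    show "digit (nstrs N) c (str_num (rev x)) = str_num (f x)" if "length x \<le> N" for x
      using c(2)[of "str_num (rev x)"] that length_le_iff[of "rev x" N] by (simp add: nstrs_def)
  qed
qed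

text \<open>Unique decoding of the self-delimiting entries. Only the first \<open>B\<close> digits
  are recovered, as higher digits of \<open>c\<close> leave no trace in the table.\<close>

lemma num_table_inj:
  assumes "num_table B c = num_table B' c'"
  shows "B = B'" "i < B \<Longrightarrow> digit B c i = digit B' c' i"
proof -
  have "concat (map sd_code (map (\<lambda>i. num_str (digit B c i)) [0..<B])) =
    concat (map sd_code (map (\<lambda>i. num_str (digit B' c' i)) [0..<B']))"
    using assms unfolding num_table_eq by (simp add: comp_def)
  then have eq: "map (\<lambda>i. num_str (digit B c i)) [0..<B] = map (\<lambda>i. num_str (digit B' c' i)) [0..<B']"
    by (rule concat_sd_code_inj)
  from arg_cong[OF eq, of length] show B: "B = B'" by simp
  show "digit B c i = digit B' c' i" if "i < B"
    using eq that unfolding B by (auto dest!: bspec[where x = i] arg_cong[where f = str_num])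
qed

section \<open>Upper bounds on complexity\<close>

text \<open>A program for \<open>a\<close> describes \<open>f a\<close> given the table: compute
  \<open>a\<close> from the empty condition, whose number is 0, and look up its entry.\<close>

lemma KSc_le_KS_table:
  assumes U: "optimal U"
  shows "\<exists>d. \<forall>N f a. (\<forall>x. length x \<le> N \<longrightarrow> length (f x) \<le> N) \<longrightarrow> length a \<le> N \<longrightarrow>
    KSc U (f a) (table_code N f) \<le> KS U a + d"
proof -
  let ?U = "\<lambda>p y x. U (num_str p) (num_str y) = Some (num_str x)"
  let ?G = "\<lambda>p y x. \<exists>a B c. ?U p 0 a \<and> y = num_table B c \<and> str_rev a < B \<and> x = digit B c (str_rev a)"
  have "recenum (\<lambda>e. ?G (nfst (nfst e)) (nsnd (nfst e)) (nsnd e))"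
    by (intro recenum_intros recenum_comp3[OF optimal_graph[OF U]] recenum_decid decid_eq decid_less
        comput_basic comput_num_table comput_digit comput_str_rev)
  moreover have "x = x'" if "?G p y x" "?G p y x'" for p y x x'
  proof -
    obtain a B c where 1: "?U p 0 a" "y = num_table B c" "str_rev a < B" "x = digit B c (str_rev a)"
      using \<open>?G p y x\<close> by blast
    obtain a' B' c' where 2: "?U p 0 a'" "y = num_table B' c'" "str_rev a' < B'" "x' = digit B' c' (str_rev a')"
      using \<open>?G p y x'\<close> by blast
    have "num_str a = num_str a'" using 1(1) 2(1) by simp
    then have "a = a'" by (metis str_num_num_str)
    then show ?thesis using 1 2 num_table_inj by metis
  qed
  ultimately obtain d where d: "\<And>p y x. ?G (str_num p) (str_num y) (str_num x) \<Longrightarrow> KSc U x y \<le> length p + d"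
    using optimal_simulates[OF U, of ?G] by blast
  have "KSc U (f a) (table_code N f) \<le> KS U a + d"
    if f: "\<forall>x. length x \<le> N \<longrightarrow> length (f x) \<le> N" and a: "length a \<le> N" for N f a
  proof -
    obtain c where c: "str_num (table_code N f) = num_table (nstrs N) c"
      "digit (nstrs N) c (str_num (rev a)) = str_num (f a)"
      using table_code_num_table[of N f] f a by metis
    obtain p where p: "length p = KS U a" "U p [] = Some a"
      using KSc_attained[OF U] unfolding KS_def by blast
    have "num_str 0 = []" using num_str_str_num[of "[]"] by simp
    moreover have "str_num (rev a) < nstrs N"
      using a length_le_iff[of "rev a" N] by (simp add: nstrs_def)
    ultimately have "?G (str_num p) (str_num (table_code N f)) (str_num (f a))"
      using c p by (intro exI[of _ "str_num a"] exI[of _ "nstrs N"] exI[of _ c]) auto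
    from d[OF this] show ?thesis by (simp add: p)
  qed
  then show ?thesis by blast
qed

text \<open>The simulated machine discards its condition and runs \<open>U\<close> on the empty
  string instead.\<close>

lemma KSc_le_KS:
  assumes U: "optimal U" shows "\<exists>d. \<forall>x y. KSc U x y \<le> KS U x + d"
proof -
  let ?G = "\<lambda>p y x. U (num_str p) (num_str 0) = Some (num_str x)"
  have "recenum (\<lambda>e. ?G (nfst (nfst e)) (nsnd (nfst e)) (nsnd e))"
    by (intro recenum_comp3[OF optimal_graph[OF U]] comput_basic)
  moreover have "x = x'" if "?G p y x" "?G p y x'" for p y x x'
    using that by (metis option.inject str_num_num_str)
  ultimately obtain d where d: "\<And>p y x. ?G (str_num p) (str_num y) (str_num x) \<Longrightarrow> KSc U x y \<le> length p + d"
    using optimal_simulates[OF U, of ?G] by blast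
  have "num_str 0 = []" using num_str_str_num[of "[]"] by simp
  then have "KSc U x y \<le> KS U x + d" for x y
    using KSc_attained[OF U, of x "[]"] d[of _ x y] unfolding KS_def by force
  then show ?thesis by blast
qed

lemma KS_le_length:
  assumes U: "optimal U" shows "\<exists>d. \<forall>x. KS U x \<le> length x + d"
proof -
  have "recenum (\<lambda>e. nsnd e = nfst (nfst e))" by (intro recenum_decid decid_eq comput_basic)
  from optimal_simulates[OF U, of "\<lambda>p y x. x = p", OF this] show ?thesis
    unfolding KS_def by auto
qed

section \<open>Greedy independent sets\<close>

text \<open>The greedy maximal independent set, in the order of the natural numbers, among the
  elements of \<open>P\<close> with conflict relation \<open>R\<close>.\<close>

function greedy :: "(nat \<Rightarrow> bool) \<Rightarrow> (nat \<Rightarrow> nat \<Rightarrow> bool) \<Rightarrow> nat \<Rightarrow> bool" where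
  "greedy P R z \<longleftrightarrow> P z \<and> (\<forall>w. w < z \<longrightarrow> greedy P R w \<longrightarrow> \<not> R w z)"
  by auto
termination by (relation "measure (\<lambda>(P, R, z). z)") auto

declare greedy.simps [simp del]

text \<open>A bit mask of the members chosen below \<open>n\<close>. Keeping the whole history in
  one number reduces the course-of-values recursion of \<open>greedy\<close> to primitive
  recursion.\<close>

definition greedy_code :: "(nat \<Rightarrow> bool) \<Rightarrow> (nat \<Rightarrow> nat \<Rightarrow> bool) \<Rightarrow> nat \<Rightarrow> nat" where
  "greedy_code P R n =
    rec_nat 0 (\<lambda>z M. if P z \<and> (\<forall>w<z. M div 2 ^ w mod 2 = 1 \<longrightarrow> \<not> R w z) then M + 2 ^ z else M) n"

lemma greedy_code: "greedy_code P R n = set_encode {z. z < n \<and> greedy P R z}"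
proof (induction n)
  case (Suc n)
  let ?M = "greedy_code P R n"
  have "?M div 2 ^ w mod 2 = 1 \<longleftrightarrow> greedy P R w" if "w < n" for w
  proof -
    have "?M div 2 ^ w mod 2 = 1 \<longleftrightarrow> w \<in> set_decode ?M" by (simp add: set_decode_def odd_iff_mod_2_eq_one)
    also have "set_decode ?M = {z. z < n \<and> greedy P R z}" unfolding Suc by simp
    finally show ?thesis using that by simp
  qed
  then have "greedy_code P R (Suc n) = (if greedy P R n then ?M + 2 ^ n else ?M)"
    by (simp add: greedy_code_def greedy.simps[of P R n])
  moreover have "{z. z < Suc n \<and> greedy P R z} =
      (if greedy P R n then insert n {z. z < n \<and> greedy P R z} else {z. z < n \<and> greedy P R z})"
    by (auto simp: less_Suc_eq)
  ultimately show ?case by (simp add: Suc set_encode_insert)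
qed (simp add: greedy_code_def)

lemma decid_greedy:
  assumes P: "decid (\<lambda>e. P (nfst e) (nsnd e))" and R: "decid (\<lambda>e. R (nfst e) (nsnd e))"
    and "comput f" "comput g"
  shows "decid (\<lambda>e. greedy (P (f e)) R (g e))"
proof -
  \<comment> \<open>Membership of \<open>z\<close> is read off from whether the mask changes when
    \<open>z\<close> is processed.\<close>
  have "greedy (P x) R z \<longleftrightarrow> greedy_code (P x) R (Suc z) \<noteq> greedy_code (P x) R z" for x z
  proof -
    have "{w. w < Suc z \<and> greedy (P x) R w} = {w. w < z \<and> greedy (P x) R w} \<longleftrightarrow> \<not> greedy (P x) R z"
      by (auto simp: less_Suc_eq)
    then show ?thesis unfolding greedy_code by (simp add: set_encode_eq)
  qed
  moreover have code: "comput (\<lambda>e. greedy_code (P (nfst e)) R (nsnd e))"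
  proof -
    have P': "decid (\<lambda>e. P (nfst (nfst (nfst e))) (nsnd (nfst e)))"
      using decid_comp[OF P, of "\<lambda>e. npair (nfst (nfst (nfst e))) (nsnd (nfst e))"] by (simp add: comput_basic)
    have R': "decid (\<lambda>e. R (nsnd e) (nsnd (nfst (nfst e))))"
      using decid_comp[OF R, of "\<lambda>e. npair (nsnd e) (nsnd (nfst (nfst e)))"] by (simp add: comput_basic)
    show ?thesis unfolding greedy_code_def
      by (intro comput_intros decid_and decid_all decid_imp decid_not decid_eq P' R' comput_div comput_mod)
  qed
  moreover have "decid (\<lambda>e. greedy_code (P (f e)) R (Suc (g e)) \<noteq> greedy_code (P (f e)) R (g e))"
    by (intro decid_not decid_eq comput_comp2[OF code] comput_Suc assms)
  ultimately show ?thesis by simp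
qed

definition greedy_rank :: "(nat \<Rightarrow> bool) \<Rightarrow> (nat \<Rightarrow> nat \<Rightarrow> bool) \<Rightarrow> nat \<Rightarrow> nat" where
  "greedy_rank P R z = card {w. w < z \<and> greedy P R w}"

lemma comput_greedy_rank:
  assumes P: "decid (\<lambda>e. P (nfst e) (nsnd e))" and R: "decid (\<lambda>e. R (nfst e) (nsnd e))"
    and "comput f" "comput g"
  shows "comput (\<lambda>e. greedy_rank (P (f e)) R (g e))"
proof -
  have eq: "greedy_rank P R z = rec_nat 0 (\<lambda>w r. if greedy P R w then Suc r else r) z" for P z
  proof (induction z)
    case (Suc z)
    have "{w. w < Suc z \<and> greedy P R w} =
        (if greedy P R z then insert z {w. w < z \<and> greedy P R w} else {w. w < z \<and> greedy P R w})"
      by (auto simp: less_Suc_eq)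
    then show ?case using Suc by (simp add: greedy_rank_def)
  qed (simp add: greedy_rank_def)
  have "comput (\<lambda>e. greedy_rank (P (nfst e)) R (nsnd e))" unfolding eq
    by (intro comput_rec comput_if decid_greedy[OF P R] comput_basic)
  from comput_comp2[OF this assms(3,4)] show ?thesis .
qed

text \<open>The rank is strictly increasing along the members, so it can serve as an index in
  descriptions.\<close>

lemma greedy_rank_inj:
  assumes "greedy P R z" "greedy P R z'" "greedy_rank P R z = greedy_rank P R z'"
  shows "z = z'"
proof -
  have less: "greedy_rank P R z < greedy_rank P R z'" if "z < z'" "greedy P R z" for z z'
    unfolding greedy_rank_def using that by (intro psubset_card_mono) auto
  show ?thesis using less[of z z'] less[of z' z] assms by (cases z z' rule: linorder_cases) auto
qed

text \<open>Either \<open>z\<close> is chosen and conflicts with itself by reflexivity, or an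
  earlier member blocks it.\<close>

lemma greedy_maximal:
  assumes "P z" "\<And>z. R z z" shows "\<exists>w. greedy P R w \<and> R w z"
  using assms greedy.simps[of P R z] by blast

lemma greedy_independent:
  "greedy P R w \<Longrightarrow> greedy P R z \<Longrightarrow> w < z \<Longrightarrow> \<not> R w z"
  using greedy.simps[of P R z] by blast

section \<open>Forced pairs\<close>

text \<open>Here \<open>e\<close> packs \<open>(N, s)\<close> and \<open>z\<close> packs \<open>(t, u, v)\<close>, where \<open>u, v\<close> are the numbers of the strings
  \<open>a, b\<close>. The predicate says that within \<open>t\<close> steps of computation (\<open>Q\<close> is the step-bounded graph of the
  optimal machine) it turns out that every table mapping \<open>a\<close> to \<open>b\<close> yields \<open>b\<close> from a program shorter
  than \<open>s\<close>. There are \<open>2 ^ s - 1\<close> such programs.\<close>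

definition forced :: "(nat \<Rightarrow> bool) \<Rightarrow> nat \<Rightarrow> nat \<Rightarrow> bool" where
  "forced Q e z \<longleftrightarrow> nfst (nsnd z) < nstrs (nfst e) \<and> nsnd (nsnd z) < nstrs (nfst e) \<and>
     (\<forall>c < nstrs (nfst e) ^ nstrs (nfst e). digit (nstrs (nfst e)) c (str_rev (nfst (nsnd z))) = nsnd (nsnd z) \<longrightarrow>
       (\<exists>q < 2 ^ nsnd e - 1. \<exists>t < nfst z.
          Q (npair t (npair (npair q (num_table (nstrs (nfst e)) c)) (nsnd (nsnd z))))))"

text \<open>The time component is ignored, so a pair certified at several times conflicts with
  itself and is chosen at most once.\<close>

definition touching :: "nat \<Rightarrow> nat \<Rightarrow> bool" where
  "touching w z \<longleftrightarrow> nfst (nsnd w) = nfst (nsnd z) \<or> nsnd (nsnd w) = nsnd (nsnd z)"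

lemma decid_forced:
  assumes "decid Q" shows "decid (\<lambda>e. forced Q (nfst e) (nsnd e))"
  unfolding forced_def nstrs_def
  by (intro decid_and decid_all decid_imp decid_ex decid_less decid_eq decid_comp[OF assms]
      comput_basic comput_power comput_digit comput_str_rev comput_num_table)

lemma decid_touching: "decid (\<lambda>e. touching (nfst e) (nsnd e))"
  unfolding touching_def by (intro decid_or decid_eq comput_basic)

text \<open>Distinct first components let a single table pass through all pairs of \<open>Z\<close>.
  Given that table, the distinct second components have programs below \<open>2 ^ s - 1\<close>, and
  these differ because \<open>Q\<close> is single-valued.\<close>

lemma card_matching:
  assumes Q: "\<And>q y v v' t t'. Q (npair t (npair (npair q y) v)) \<Longrightarrow> Q (npair t' (npair (npair q y) v')) \<Longrightarrow> v = v'"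
    and fin: "finite Z" and forced: "\<And>z. z \<in> Z \<Longrightarrow> forced Q (npair N s) z"
    and match: "\<And>w z. w \<in> Z \<Longrightarrow> z \<in> Z \<Longrightarrow> touching w z \<Longrightarrow> w = z"
  shows "card Z \<le> 2 ^ s - 1"
proof -
  let ?B = "nstrs N" and ?u = "\<lambda>z. str_rev (nfst (nsnd z))" and ?v = "\<lambda>z. nsnd (nsnd z)"
  have u: "inj_on ?u Z"
  proof (rule inj_onI)
    fix w z assume "w \<in> Z" "z \<in> Z" "?u w = ?u z"
    then have "nfst (nsnd w) = nfst (nsnd z)" by (metis str_rev_str_rev)
    then show "w = z" using match \<open>w \<in> Z\<close> \<open>z \<in> Z\<close> by (simp add: touching_def)
  qed
  \<comment> \<open>Positions outside the matching get the default 0, the empty string, which is an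
    admissible value.\<close>
  define g where "g i = (if i \<in> ?u ` Z then ?v (inv_into Z ?u i) else 0)" for i
  have gu: "g (?u z) = ?v z" if "z \<in> Z" for z
    using that u by (simp add: g_def inv_into_f_f[OF u])
  have "g i < ?B" for i
  proof (cases "i \<in> ?u ` Z")
    case True
    then obtain z where "z \<in> Z" "i = ?u z" by blast
    then show ?thesis using gu[of z] forced[of z] by (simp add: forced_def)
  qed (simp add: g_def)
  then obtain c where c: "c < ?B ^ ?B" "\<And>i. i < ?B \<Longrightarrow> digit ?B c i = g i"
    using digits_exist[of ?B g ?B] by blast
  have "\<exists>q < 2 ^ s - 1. \<exists>t. Q (npair t (npair (npair q (num_table ?B c)) (?v z)))" if z: "z \<in> Z" for z
  proof -
    have "?u z < ?B" using forced[OF z] unfolding forced_def by (auto intro: str_rev_less)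
    then have "digit ?B c (?u z) = ?v z" using c(2) gu z by simp
    then show ?thesis using forced[OF z] c(1) unfolding forced_def by force
  qed
  then obtain q where q: "\<And>z. z \<in> Z \<Longrightarrow> q z < 2 ^ s - 1"
    "\<And>z. z \<in> Z \<Longrightarrow> \<exists>t. Q (npair t (npair (npair (q z) (num_table ?B c)) (?v z)))" by metis
  have "inj_on q Z"
  proof (rule inj_onI)
    fix w z assume wz: "w \<in> Z" "z \<in> Z" "q w = q z"
    then have "?v w = ?v z" using q(2)[of w] q(2)[of z] Q by metis
    then show "w = z" using match wz by (simp add: touching_def)
  qed
  then have "card Z \<le> card {..<(2::nat) ^ s - 1}"
    by (rule card_inj_on_le) (use q(1) in auto)
  then show ?thesis by simp
qed

lemma min_KS_le_of_forced:
  assumes U: "optimal U"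
  shows "\<exists>d. \<forall>N s a b. length a \<le> N \<longrightarrow> length b \<le> N \<longrightarrow>
    (\<forall>f. (\<forall>x. length x \<le> N \<longrightarrow> length (f x) \<le> N) \<longrightarrow> f a = b \<longrightarrow> KSc U b (table_code N f) < s) \<longrightarrow>
    min (KS U a) (KS U b) \<le> s + 2 * length (num_str N) + 2 * length (num_str s) + d"
proof -
  obtain Q where Q: "decid Q" "\<And>p y x. U (num_str p) (num_str y) = Some (num_str x) \<longleftrightarrow>
      (\<exists>t. Q (npair t (npair (npair p y) x)))"
  proof -
    obtain Q where "decid Q" "\<And>e. U (num_str (nfst (nfst e))) (num_str (nsnd (nfst e))) = Some (num_str (nsnd e)) \<longleftrightarrow>
      (\<exists>t. Q (npair t e))"
      using optimal_graph[OF U] unfolding recenum_def by blast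
    then show ?thesis using that[of Q] by (metis nfst_npair nsnd_npair)
  qed
  have Qf: "v = v'" if "Q (npair t (npair (npair q y) v))" "Q (npair t' (npair (npair q y) v'))" for q y v v' t t'
    using that Q(2)[of q y v] Q(2)[of q y v'] by (metis option.inject str_num_num_str)
  let ?gr = "\<lambda>N s. greedy (forced Q (npair N s)) touching"
  let ?rk = "\<lambda>N s. greedy_rank (forced Q (npair N s)) touching"
  \<comment> \<open>A description consists of self-delimiting codes of \<open>N\<close> and
    \<open>s\<close> followed by the plain index \<open>j\<close>; \<open>sel\<close> picks the
    first or second component of the member with that index.\<close>
  let ?G = "\<lambda>sel p y x. \<exists>N s j z. p = sd_app N (sd_app s j) \<and> ?gr N s z \<and> ?rk N s z = j \<and> x = sel (nsnd z)"
  have sim: "\<exists>d. \<forall>p y x. ?G sel (str_num p) (str_num y) (str_num x) \<longrightarrow> KSc U x y \<le> length p + d"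
    if sel: "comput sel" for sel
  proof (rule optimal_simulates[OF U])
    show "recenum (\<lambda>e. ?G sel (nfst (nfst e)) (nsnd (nfst e)) (nsnd e))"
      by (intro recenum_ex recenum_decid decid_and decid_eq decid_greedy comput_greedy_rank
          decid_forced decid_touching Q(1) comput_basic comput_sd_app comput_comp[OF sel])
  next
    fix p y x x' :: nat
    assume "?G sel p y x" "?G sel p y x'"
    then obtain N s j z N' s' j' z' where
      1: "p = sd_app N (sd_app s j)" "?gr N s z" "?rk N s z = j" "x = sel (nsnd z)" and
      2: "p = sd_app N' (sd_app s' j')" "?gr N' s' z'" "?rk N' s' z' = j'" "x' = sel (nsnd z')" by blast
    have sd: "sd_app n (sd_app m k) = str_num (sd_code (num_str n) @ sd_code (num_str m) @ num_str k)" for n m k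
      using sd_app_str_num[of "num_str m" "num_str k"]
        sd_app_str_num[of "num_str n" "sd_code (num_str m) @ num_str k"] by simp
    have "num_str N = num_str N'" "num_str s = num_str s'" "num_str j = num_str j'"
      using 1(1) 2(1) unfolding sd by (auto simp: sd_code_append_eq)
    then have "N = N'" "s = s'" "j = j'" by (metis str_num_num_str)+
    then have "z = z'" using 1 2 greedy_rank_inj by metis
    then show "x = x'" using 1 2 by simp
  qed
  obtain d1 where d1: "\<And>p y x. ?G nfst (str_num p) (str_num y) (str_num x) \<Longrightarrow> KSc U x y \<le> length p + d1"
    using sim[OF comput_nfst[OF comput_id]] by blast
  obtain d2 where d2: "\<And>p y x. ?G nsnd (str_num p) (str_num y) (str_num x) \<Longrightarrow> KSc U x y \<le> length p + d2"
    using sim[OF comput_nsnd[OF comput_id]] by blast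
  \<comment> \<open>The 4 pays for the end markers of the two self-delimiting codes.\<close>
  have "min (KS U a) (KS U b) \<le> s + 2 * length (num_str N) + 2 * length (num_str s) + (d1 + d2 + 4)"
    if a: "length a \<le> N" and b: "length b \<le> N" and
      f: "\<And>f. (\<forall>x. length x \<le> N \<longrightarrow> length (f x) \<le> N) \<Longrightarrow> f a = b \<Longrightarrow> KSc U b (table_code N f) < s"
    for N s a b
  proof -
    let ?B = "nstrs N"
    have ab: "str_num a < ?B" "str_num b < ?B" using a b by (auto simp: length_le_iff nstrs_def)
    have "\<exists>t. digit ?B c (str_rev (str_num a)) = str_num b \<longrightarrow>
      (\<exists>q < 2 ^ s - 1. Q (npair t (npair (npair q (num_table ?B c)) (str_num b))))" for c
    proof (cases "digit ?B c (str_rev (str_num a)) = str_num b")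
      case True
      let ?f = "\<lambda>x. num_str (digit ?B c (str_num (rev x)))"
      have "length (?f x) \<le> N" for x
        by (simp add: length_le_nstrs digit_def)
      moreover have "?f a = b" using True by simp
      ultimately have "KSc U b (table_code N ?f) < s" using f[of ?f] by blast
      then obtain p where p: "length p < s" "U p (table_code N ?f) = Some b"
        using KSc_attained[OF U, of b "table_code N ?f"] by metis
      \<comment> \<open>The programs shorter than \<open>s\<close> are those numbered below
        \<open>2 ^ s - 1\<close>; for \<open>s = 0\<close> there are none.\<close>
      have "str_num p < 2 ^ s - 1"
        using p(1) length_le_iff[of p "s - 1"] by (cases s) auto
      moreover have "\<exists>t. Q (npair t (npair (npair (str_num p) (num_table ?B c)) (str_num b)))"
        unfolding Q(2)[symmetric] num_table_nstrs using p(2) by simp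
      ultimately show ?thesis by blast
    qed auto
    then have "\<forall>c<?B ^ ?B. \<exists>t. digit ?B c (str_rev (str_num a)) = str_num b \<longrightarrow>
      (\<exists>q < 2 ^ s - 1. Q (npair t (npair (npair q (num_table ?B c)) (str_num b))))" by blast
    \<comment> \<open>There are finitely many table codes, so one time bound \<open>T\<close> serves
      them all and the pair enters the enumeration.\<close>
    from bounded_collection[OF this] obtain T where T: "\<forall>c<?B ^ ?B. \<exists>t<T. digit ?B c (str_rev (str_num a)) = str_num b \<longrightarrow>
      (\<exists>q < 2 ^ s - 1. Q (npair t (npair (npair q (num_table ?B c)) (str_num b))))" by blast
    have "forced Q (npair N s) (npair T (npair (str_num a) (str_num b)))"
      unfolding forced_def using ab T by (simp del: str_rev_str_num) blast
    from greedy_maximal[of "forced Q (npair N s)", OF this, of touching]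
    obtain w where w: "?gr N s w" "touching w (npair T (npair (str_num a) (str_num b)))"
      by (auto simp: touching_def)
    define j where "j = ?rk N s w"
    have "Suc j = card {z. z \<le> w \<and> ?gr N s z}"
    proof -
      have "{z. z \<le> w \<and> ?gr N s z} = insert w {z. z < w \<and> ?gr N s z}" using w(1) by auto
      then show ?thesis by (simp add: j_def greedy_rank_def)
    qed
    also have "\<dots> \<le> 2 ^ s - 1"
    proof (rule card_matching[OF Qf])
      show "forced Q (npair N s) z" if "z \<in> {z. z \<le> w \<and> ?gr N s z}" for z
        using that greedy.simps by blast
      show "v = z" if "v \<in> {z. z \<le> w \<and> ?gr N s z}" "z \<in> {z. z \<le> w \<and> ?gr N s z}" "touching v z" for v z
        using that greedy_independent[of _ touching v z] greedy_independent[of _ touching z v]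
        by (cases v z rule: linorder_cases) (auto simp: touching_def)
    qed auto
    \<comment> \<open>Weakened to the form in which \<open>length_le_iff\<close> bounds the length
      by \<open>s\<close>.\<close>
    finally have "j < 2 ^ Suc s - 1" by simp
    then have j: "length (num_str j) \<le> s" by (simp add: length_le_iff del: power_Suc)
    define p where "p = sd_code (num_str N) @ sd_code (num_str s) @ num_str j"
    have sd_len: "length (sd_code x) = 2 * length x + 2" for x
      by (induction x) (auto simp: sd_code_def)
    have lp: "length p \<le> s + 2 * length (num_str N) + 2 * length (num_str s) + 4"
      using j by (simp add: p_def sd_len)
    have p: "str_num p = sd_app N (sd_app s j)"
      using sd_app_str_num[of "num_str s" "num_str j"]
        sd_app_str_num[of "num_str N" "sd_code (num_str s) @ num_str j"] by (simp add: p_def)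
    from w(2) have "KS U a \<le> length p + d1 \<or> KS U b \<le> length p + d2"
      unfolding touching_def KS_def
    proof
      assume "nfst (nsnd w) = nfst (nsnd (npair T (npair (str_num a) (str_num b))))"
      then have "?G nfst (str_num p) (str_num []) (str_num a)"
        by (intro exI[of _ N] exI[of _ s] exI[of _ j] exI[of _ w]) (simp add: p w(1) j_def)
      then show "KSc U a [] \<le> length p + d1 \<or> KSc U b [] \<le> length p + d2" using d1 by blast
    next
      assume "nsnd (nsnd w) = nsnd (nsnd (npair T (npair (str_num a) (str_num b))))"
      then have "?G nsnd (str_num p) (str_num []) (str_num b)"
        by (intro exI[of _ N] exI[of _ s] exI[of _ j] exI[of _ w]) (simp add: p w(1) j_def)
      then show "KSc U a [] \<le> length p + d1 \<or> KSc U b [] \<le> length p + d2" using d2 by blast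
    qed
    then show ?thesis using lp by linarith
  qed
  then show ?thesis by blast
qed

section \<open>The logarithmic estimate\<close>

lemma length_num_str_le:
  assumes "real (Suc n) \<le> 2 powr r" shows "real (length (num_str n)) \<le> r"
proof -
  have "2 ^ length (num_str n) \<le> Suc n" using str_num_bounds(1)[of "num_str n"] by simp
  then have "2 powr real (length (num_str n)) \<le> real (Suc n)"
    by (simp add: powr_realpow) (metis of_nat_Suc of_nat_le_iff of_nat_numeral of_nat_power)
  then have "2 powr real (length (num_str n)) \<le> 2 powr r" using assms by linarith
  then show ?thesis by simp
qed

theorem theorem1:
  fixes U :: "bool list \<Rightarrow> bool list \<Rightarrow> bool list option"
  assumes "optimal U"
  shows "\<exists>C::real. \<forall>N::nat. N \<ge> 2 \<longrightarrow> (\<forall>a b::bool list. length a \<le> N \<longrightarrow> length b \<le> N \<longrightarrow>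
           (\<exists>f :: bool list \<Rightarrow> bool list.
              (\<forall>x. length x \<le> N \<longrightarrow> length (f x) \<le> N) \<and> f a = b \<and>
              \<bar>real (KSc U b (table_code N f)) - real (min (KS U a) (KS U b))\<bar> \<le> C * log 2 N))"
proof -
  obtain d0 where d0: "\<And>x. KS U x \<le> length x + d0" using KS_le_length[OF assms] by blast
  obtain d1 where d1: "\<And>N f a. (\<forall>x. length x \<le> N \<longrightarrow> length (f x) \<le> N) \<Longrightarrow> length a \<le> N \<Longrightarrow>
    KSc U (f a) (table_code N f) \<le> KS U a + d1" using KSc_le_KS_table[OF assms] by blast
  obtain d2 where d2: "\<And>x y. KSc U x y \<le> KS U x + d2" using KSc_le_KS[OF assms] by blast
  obtain d3 where d3: "\<And>N s a b. length a \<le> N \<Longrightarrow> length b \<le> N \<Longrightarrow>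
    (\<And>f. (\<forall>x. length x \<le> N \<longrightarrow> length (f x) \<le> N) \<Longrightarrow> f a = b \<Longrightarrow> KSc U b (table_code N f) < s) \<Longrightarrow>
    min (KS U a) (KS U b) \<le> s + 2 * length (num_str N) + 2 * length (num_str s) + d3"
    using min_KS_le_of_forced[OF assms] by blast
  \<comment> \<open>Chosen so that \<open>Suc (Suc k) \<le> N + K\<close> for the maximum
    \<open>k\<close> below.\<close>
  define K where "K = d0 + d1 + d2 + 2"
  \<comment> \<open>The coefficient 6 of \<open>L\<close> in the final estimate plus all additive
    constants, which are absorbed because \<open>L \<ge> 1\<close>.\<close>
  define C where "C = real (7 + 2 * K + d1 + d2 + d3)"
  show ?thesis
  proof (rule exI[of _ C], intro allI impI)
    fix N :: nat and a b :: "bool list"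
    assume N: "2 \<le> N" and a: "length a \<le> N" and b: "length b \<le> N"
    define m where "m = min (KS U a) (KS U b)"
    define L where "L = log 2 N"
    have L: "1 \<le> L" "2 powr L = N" using N by (simp_all add: L_def le_log_iff)
    let ?F = "\<lambda>f. (\<forall>x. length x \<le> N \<longrightarrow> length (f x) \<le> N) \<and> f a = b"
    have upper: "KSc U b (table_code N f) \<le> m + (d1 + d2)" if "?F f" for f
      using d1[of N f a] that a d2[of b "table_code N f"] by (auto simp: m_def)
    \<comment> \<open>All values of the conditional complexity over admissible functions. They are
      bounded by \<open>upper\<close>, so a maximum \<open>k\<close> exists even though the
      functions form an infinite set.\<close>
    define S where "S = (\<lambda>f. KSc U b (table_code N f)) ` {f. ?F f}"
    have fin: "finite S" unfolding S_def by (rule finite_subset[of _ "{..m + (d1 + d2)}"]) (use upper in auto)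
    have SI: "KSc U b (table_code N f) \<in> S" if "?F f" for f
      unfolding S_def using that by (intro imageI CollectI)
    have "KSc U b (table_code N (\<lambda>_. b)) \<in> S" by (rule SI) (simp add: b)
    then have "S \<noteq> {}" by (rule contrapos_pn) simp
    define k where "k = Max S"
    have "k \<in> S" unfolding k_def using fin \<open>S \<noteq> {}\<close> by (rule Max_in)
    then obtain f where f: "?F f" "KSc U b (table_code N f) = k" unfolding S_def by (elim imageE) simp
    have le: "k \<le> m + (d1 + d2)" using upper f by blast
    have "m \<le> N + d0" using d0[of b] b unfolding m_def by linarith
    then have s: "Suc (Suc k) \<le> N + K" using le by (simp add: K_def)
    have "m \<le> Suc k + 2 * length (num_str N) + 2 * length (num_str (Suc k)) + d3"
      unfolding m_def
    \<comment> \<open>Maximality of \<open>k\<close> says that the pair \<open>(a, b)\<close> is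
      forced at level \<open>Suc k\<close>.\<close>
    proof (rule d3[OF a b])
      fix g assume "\<forall>x. length x \<le> N \<longrightarrow> length (g x) \<le> N" "g a = b"
      then have "KSc U b (table_code N g) \<in> S" by (intro SI conjI)
      then show "KSc U b (table_code N g) < Suc k" using fin by (simp add: k_def less_Suc_eq_le)
    qed
    then have "real m \<le> real (Suc k + 2 * length (num_str N) + 2 * length (num_str (Suc k)) + d3)"
      by (rule of_nat_mono)
    moreover have "real (length (num_str N)) \<le> 2 * L"
    proof (rule length_num_str_le)
      have "Suc N \<le> N * N" using N mult_le_mono1[of 2 N N] by linarith
      then have "real (Suc N) \<le> real N * real N" by (metis of_nat_le_iff of_nat_mult)
      also have "\<dots> = 2 powr (2 * L)" unfolding mult_2 powr_add L(2) ..
      finally show "real (Suc N) \<le> 2 powr (2 * L)" .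
    qed
    moreover have "real (length (num_str (Suc k))) \<le> L + K"
    proof (rule length_num_str_le)
      \<comment> \<open>Gives \<open>N + K \<le> N * 2 ^ K\<close>, so the logarithm of
        \<open>N + K\<close> exceeds \<open>L\<close> by at most the constant
        \<open>K\<close>.\<close>
      have "K + 1 \<le> 2 ^ K" by (induction K) auto
      have "N + K \<le> N * (K + 1)" using N by (cases N) auto
      also have "\<dots> \<le> N * 2 ^ K" using \<open>K + 1 \<le> 2 ^ K\<close> by (rule mult_le_mono2)
      finally have "real (Suc (Suc k)) \<le> real (N * 2 ^ K)" using s by linarith
      also have "\<dots> = 2 powr (L + K)" by (simp add: powr_add L(2) powr_realpow)
      finally show "real (Suc (Suc k)) \<le> 2 powr (L + K)" .
    qed
    ultimately have "real m \<le> real k + 1 + 2 * (2 * L) + 2 * (L + K) + d3"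
      by simp
    moreover have "real k \<le> real m + (d1 + d2)" using le by linarith
    moreover have "6 * L + (1 + 2 * K + d1 + d2 + d3) \<le> C * L"
    proof -
      have "real (1 + 2 * K + d1 + d2 + d3) * 1 \<le> real (1 + 2 * K + d1 + d2 + d3) * L"
        using L(1) by (intro mult_left_mono) auto
      then show ?thesis by (simp add: C_def algebra_simps)
    qed
    ultimately have "\<bar>real k - real m\<bar> \<le> C * L" using L(1) by (simp add: abs_le_iff)
    then show "\<exists>f. (\<forall>x. length x \<le> N \<longrightarrow> length (f x) \<le> N) \<and> f a = b \<and>
      \<bar>real (KSc U b (table_code N f)) - real (min (KS U a) (KS U b))\<bar> \<le> C * log 2 N"
      using f unfolding m_def L_def by blast
  qed
qed

end
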